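(* Let $\vec{\mathcal H}$ be a finite sequence of conjugacy classes of finitely generated subgroups of $F(\mathcal B)$. The following are equivalent: (1) there is $\alpha\in\mathrm{Aut}(F(\mathcal B))$ such that $\Sigma(\alpha\vec{\mathcal H})$ can be visibly blown up; (2) for some Gersten representative $\vec{\mathcal H}'$ of $\vec{\mathcal H}$, $\Sigma(\vec{\mathcal H}')$ can be visibly blown up; (3) for every Gersten representative $\vec{\mathcal H}'$ of $\vec{\mathcal H}$, $\Sigma(\vec{\mathcal H}')$ can be visibly blown up.
   Context: $F(\mathcal B)$ is the free group on a finite set $\mathcal B$, identified with $\pi_1$ of the rose $R_{\mathcal B}$. For a conjugacy class $[[H]]$ of a finitely generated subgroup, $\Sigma([[H]])$ is the core of the covering graph of $R_{\mathcal B}$ corresponding to $H$, a finite graph with oriented edges labeled in $\mathcal B^{\pm1}$ (empty if $H=1$); for a sequence, $\Sigma(\vec{\mathcal H})$ is the sequence of these graphs, and automorphisms act componentwise. The complexity of $\vec{\mathcal H}$ is the total number of edges of $\Sigma(\vec{\mathcal H})$; $\vec{\mathcal H}'$ is a Gersten representative of $\vec{\mathcal H}$ if $\vec{\mathcal H}'=\beta\vec{\mathcal H}$ for some automorphism $\beta$ and has minimal complexity among all $\alpha\vec{\mathcal H}$, $\alpha\in\mathrm{Aut}(F(\mathcal B))$. A sequence $(\Sigma_i)_{i\in I}$ of labeled graphs can be visibly blown up if there is a partition $\mathcal B=\mathcal B'\sqcup\mathcal B''$ into two nonempty sets such that for each $i$, the labels of $\Sigma_i$ all lie in $\mathcal B'^{\pm1}$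 or all lie in $\mathcal B''^{\pm1}$. *)

theory Defs
  imports "HOL-Algebra.Algebra"
begin

text \<open>A letter is a generator together with an exponent flag (True = inverse).\<close>
type_synonym 'b letter = "'b \<times> bool"
type_synonym 'b word = "'b letter list"

definition inv_letter :: "'b letter \<Rightarrow> 'b letter" where
  "inv_letter x = (fst x, \<not> snd x)"

fun reduced :: "'b word \<Rightarrow> bool" where
  "reduced (x # y # ys) = (y \<noteq> inv_letter x \<and> reduced (y # ys))"
| "reduced _ = True"

fun cancel :: "'b letter \<Rightarrow> 'b word \<Rightarrow> 'b word" where
  "cancel x [] = [x]"
| "cancel x (y # ys) = (if y = inv_letter x then ys else x # y # ys)"

definition red :: "'b word \<Rightarrow> 'b word" where
  "red w = foldr cancel w []"

definition free_group :: "'b set \<Rightarrow> 'b word monoid" where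
  "free_group B = \<lparr> carrier = {w. reduced w \<and> fst ` set w \<subseteq> B},
                    monoid.mult = (\<lambda>u v. red (u @ v)),
                    one = [] \<rparr>"

definition cyclically_reduced :: "'b word \<Rightarrow> bool" where
  "cyclically_reduced w \<longleftrightarrow> w \<noteq> [] \<and> reduced w \<and> last w \<noteq> inv_letter (hd w)"

definition fin_gen_subgroup :: "'b set \<Rightarrow> 'b word set \<Rightarrow> bool" where
  "fin_gen_subgroup B H \<longleftrightarrow> subgroup H (free_group B) \<and>
     (\<exists>S. finite S \<and> S \<subseteq> carrier (free_group B) \<and> H = generate (free_group B) S)"

text \<open>The covering graph of the rose R_B for H has vertices the right cosets H g and,
  for each coset C and generator b, an edge labelled b from C to C b; such an edge is
  encoded by the pair (C, b). The core is the union of all immersed closed loops, i.e. of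
  all closed paths reading a (nonempty) cyclically reduced word. Reading letter w!i from
  vertex H g p (p = take i w) traverses the edge (H g p, b) if the letter is b, and the
  edge (H g p b^-1, b) = (H g take (i+1) w, b) if the letter is b^-1.\<close>

definition core_edges :: "'b set \<Rightarrow> 'b word set \<Rightarrow> ('b word set \<times> 'b) set" where
  "core_edges B H =
     {e. \<exists>g w i. g \<in> carrier (free_group B) \<and> w \<in> carrier (free_group B) \<and>
            cyclically_reduced w \<and>
            r_coset (free_group B) H (g \<otimes>\<^bsub>free_group B\<^esub> w) = r_coset (free_group B) H g \<and>
            i < length w \<and>
            e = (if snd (w ! i)
                 then (r_coset (free_group B) H (g \<otimes>\<^bsub>free_group B\<^esub> take (Suc i) w), fst (w ! i))
                 else (r_coset (free_group B) H (g \<otimes>\<^bsub>free_group B\<^esub> take i w), fst (w ! i)))}"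

definition core_labels :: "'b set \<Rightarrow> 'b word set \<Rightarrow> 'b set" where
  "core_labels B H = snd ` core_edges B H"

definition complexity :: "'b set \<Rightarrow> 'b word set list \<Rightarrow> nat" where
  "complexity B Hs = (\<Sum>H\<leftarrow>Hs. card (core_edges B H))"

definition Aut_F :: "'b set \<Rightarrow> ('b word \<Rightarrow> 'b word) set" where
  "Aut_F B = iso (free_group B) (free_group B)"

definition act :: "('b word \<Rightarrow> 'b word) \<Rightarrow> 'b word set list \<Rightarrow> 'b word set list" where
  "act \<alpha> Hs = map (\<lambda>H. \<alpha> ` H) Hs"

definition gersten_rep :: "'b set \<Rightarrow> 'b word set list \<Rightarrow> 'b word set list \<Rightarrow> bool" where
  "gersten_rep B Hs Hs' \<longleftrightarrow>
     (\<exists>\<beta>\<in>Aut_F B. Hs' = act \<beta> Hs) \<and>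
     (\<forall>\<alpha>\<in>Aut_F B. complexity B Hs' \<le> complexity B (act \<alpha> Hs))"

definition visibly_blown_up :: "'b set \<Rightarrow> 'b word set list \<Rightarrow> bool" where
  "visibly_blown_up B Hs \<longleftrightarrow>
     (\<exists>B1 B2. B1 \<union> B2 = B \<and> B1 \<inter> B2 = {} \<and> B1 \<noteq> {} \<and> B2 \<noteq> {} \<and>
        (\<forall>H\<in>set Hs. core_labels B H \<subseteq> B1 \<or> core_labels B H \<subseteq> B2))"

end

theory Submission
  imports Defs
begin

text \<open>Suppose that \<open>Hs\<close> has minimal complexity and that \<open>\<alpha>\<close> makes it visibly blown up along
  \<open>B = B1 \<union> B2\<close>. Call the \<^emph>\<open>Whitehead graph\<close> the hypergraph on the letters whose hyperedges
  are the sets of directions at the vertices of the cores. Colour a group element \<open>g\<close> by whether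
  \<open>\<alpha> g\<close> begins with a letter of \<open>B1\<close>; the colour is constant near each end of the Cayley
  tree, and the ends of every conjugate of a member of \<open>Hs\<close> share one colour. Let \<open>v\<close> be a vertex
  at maximal distance from the identity such that both colours occur at the ends beyond it. Then the
  directions at \<open>v\<close> other than the one leading back, \<open>x\<close>, are coloured, both colours occur, and
  hyperedges minus \<open>x\<close> are monochromatic. If some hyperedge joins \<open>x\<close> to the colour class that
  misses \<open>x\<inverse>\<close>, the corresponding Whitehead automorphism collapses at least one core edge,
  contradicting minimality. Otherwise the colour class is a union of components of the Whitehead
  graph; either it is closed under inversion, which is a visible blow-up, or it contains a letter
  \<open>z\<close> but not its inverse, and the same argument with \<open>z\<close> in place of \<open>x\<close> applies unless \<open>z\<close>
  labels no core edge.\<close>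

section \<open>Reduced words and the free group\<close>

text \<open>The product of \<open>free_group B\<close> does not depend on \<open>B\<close>; a
  constant without this parameter allows rewriting without carrier conditions.\<close>

definition mult_word :: "'b word \<Rightarrow> 'b word \<Rightarrow> 'b word" (infixl \<open>\<star>\<close> 70) where
  "u \<star> v = red (u @ v)"

definition inv_word :: "'b word \<Rightarrow> 'b word" where
  "inv_word w = rev (map inv_letter w)"

abbreviation words :: "'b set \<Rightarrow> 'b word set" where
  "words B \<equiv> carrier (free_group B)"

lemma inv_letter_inv_letter [simp]: "inv_letter (inv_letter x) = x"
  by (simp add: inv_letter_def)

lemma fst_inv_letter [simp]: "fst (inv_letter x) = fst x"
  by (simp add: inv_letter_def)

lemma inv_letter_neq [simp]: "inv_letter x \<noteq> x" "x \<noteq> inv_letter x"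
  by (metis inv_letter_def snd_conv)+

lemma inv_letter_eq_iff [simp]: "inv_letter x = inv_letter y \<longleftrightarrow> x = y"
  by (metis inv_letter_inv_letter)

lemma fst_eq_iff_letter: "fst x = fst y \<longleftrightarrow> x = y \<or> x = inv_letter y"
  by (auto simp: inv_letter_def prod_eq_iff)

lemma words_iff: "w \<in> words B \<longleftrightarrow> reduced w \<and> fst ` set w \<subseteq> B"
  by (simp add: free_group_def)

lemma mult_free_group [simp]: "u \<otimes>\<^bsub>free_group B\<^esub> v = u \<star> v"
  by (simp add: free_group_def mult_word_def)

lemma one_free_group [simp]: "\<one>\<^bsub>free_group B\<^esub> = []"
  by (simp add: free_group_def)

lemma reduced_Cons:
  "reduced (x # v) \<longleftrightarrow> reduced v \<and> (v \<noteq> [] \<longrightarrow> hd v \<noteq> inv_letter x)"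
  by (cases v) auto

lemma reduced_append:
  "reduced (u @ v) \<longleftrightarrow>
     reduced u \<and> reduced v \<and> (u \<noteq> [] \<longrightarrow> v \<noteq> [] \<longrightarrow> hd v \<noteq> inv_letter (last u))"
  by (induction u) (auto simp: reduced_Cons)

lemma reduced_cancel: "reduced w \<Longrightarrow> reduced (cancel x w)"
  by (cases w) (auto simp: reduced_Cons)

lemma reduced_foldr_cancel: "reduced v \<Longrightarrow> reduced (foldr cancel u v)"
  by (induction u) (auto intro: reduced_cancel)

lemma reduced_red [simp]: "reduced (red w)"
  by (simp add: red_def reduced_foldr_cancel)

lemma red_Cons: "red (x # w) = cancel x (red w)"
  by (simp add: red_def)

lemma red_Nil [simp]: "red [] = []"
  by (simp add: red_def)

lemma red_reduced: "reduced w \<Longrightarrow> red w = w"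
proof (induction w)
  case (Cons x w)
  then show ?case by (cases w) (auto simp: red_Cons)
qed simp

lemma cancel_cancel_inv: "reduced w \<Longrightarrow> cancel x (cancel (inv_letter x) w) = w"
  by (cases w) (auto simp: reduced_Cons neq_Nil_conv, (case_tac list; auto)+)

lemma red_append: "red (u @ v) = foldr cancel u (red v)"
  by (simp add: red_def)

lemma foldr_cancel_cancel:
  "reduced z \<Longrightarrow> foldr cancel (cancel x u) z = cancel x (foldr cancel u z)"
  by (cases u) (auto simp: cancel_cancel_inv reduced_foldr_cancel)

lemma foldr_cancel_red: "reduced z \<Longrightarrow> foldr cancel (red u) z = foldr cancel u z"
  by (induction u) (auto simp: red_Cons foldr_cancel_cancel)

lemma red_red_append [simp]: "red (red u @ v) = red (u @ v)"
  by (simp add: red_append foldr_cancel_red)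

lemma red_append_red [simp]: "red (u @ red v) = red (u @ v)"
  by (simp add: red_append red_reduced)

lemma red_red [simp]: "red (red v) = red v"
  by (simp add: red_reduced)

lemma inv_word_append [simp]: "inv_word (u @ v) = inv_word v @ inv_word u"
  by (simp add: inv_word_def)

lemma inv_word_Cons: "inv_word (x # v) = inv_word v @ [inv_letter x]"
  by (simp add: inv_word_def)

lemma inv_word_Nil [simp]: "inv_word [] = []"
  by (simp add: inv_word_def)

lemma inv_word_eq_Nil [simp]: "inv_word w = [] \<longleftrightarrow> w = []"
  by (simp add: inv_word_def)

lemma inv_word_singleton [simp]: "inv_word [x] = [inv_letter x]"
  by (simp add: inv_word_def)

lemma inv_word_inv_word [simp]: "inv_word (inv_word w) = w"
  by (simp add: inv_word_def rev_map comp_def)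

lemma length_inv_word [simp]: "length (inv_word w) = length w"
  by (simp add: inv_word_def)

lemma hd_inv_word: "w \<noteq> [] \<Longrightarrow> hd (inv_word w) = inv_letter (last w)"
  by (simp add: inv_word_def hd_rev last_map)

lemma last_inv_word: "w \<noteq> [] \<Longrightarrow> last (inv_word w) = inv_letter (hd w)"
  by (simp add: inv_word_def last_rev hd_map)

lemma fst_set_inv_word [simp]: "fst ` set (inv_word w) = fst ` set w"
  by (force simp: inv_word_def)

lemma reduced_inv_word [simp]: "reduced (inv_word w) \<longleftrightarrow> reduced w"
proof -
  have "reduced w \<Longrightarrow> reduced (inv_word w)" for w :: "'b word"
    by (induction w) (auto simp: inv_word_Cons reduced_append reduced_Cons last_inv_word)
  from this[of w] this[of "inv_word w"] show ?thesis by auto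
qed

lemma red_inv_word_cancel: "red (inv_word u @ u @ v) = red v"
proof (induction u)
  case (Cons x u)
  then show ?case
    using cancel_cancel_inv[of "foldr cancel u (red v)" "inv_letter x"]
    by (simp add: inv_word_Cons red_append red_Cons reduced_foldr_cancel)
qed simp

lemma mult_word_assoc: "u \<star> v \<star> w = u \<star> (v \<star> w)"
  by (simp add: mult_word_def)

lemma red_mult_word: "red (u \<star> v) = u \<star> v"
  by (simp add: mult_word_def)

lemma reduced_mult_word [simp]: "reduced (u \<star> v)"
  by (simp add: mult_word_def)

lemma mult_word_red: "u \<star> red v = u \<star> v" "red u \<star> v = u \<star> v"
  by (simp_all add: mult_word_def)

lemma mult_word_Nil: "u \<star> [] = red u" "[] \<star> u = red u"
  by (simp_all add: mult_word_def)

lemma inv_word_mult_cancel: "inv_word u \<star> (u \<star> v) = red v" "u \<star> (inv_word u \<star> v) = red v"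
  using red_inv_word_cancel[of u v] red_inv_word_cancel[of "inv_word u" v]
  by (simp_all add: mult_word_def)

lemma inv_word_mult: "inv_word u \<star> u = []" "u \<star> inv_word u = []"
  using inv_word_mult_cancel[of u "[]"] by (simp_all add: mult_word_def)

lemma inv_word_unique: "reduced u \<Longrightarrow> v \<star> u = [] \<Longrightarrow> u = red (inv_word v)"
  by (metis inv_word_mult_cancel(1) mult_word_Nil(1) red_reduced)

lemma inv_word_mult_word: "inv_word (u \<star> v) = inv_word v \<star> inv_word u"
proof -
  have "u \<star> v \<star> (inv_word v \<star> inv_word u) = []"
    by (simp add: mult_word_assoc inv_word_mult_cancel mult_word_red inv_word_mult)
  from inv_word_unique[OF _ this] show ?thesis
    by (simp add: red_reduced)
qed

lemma append_mult: "(u @ v) \<star> w = u \<star> (v \<star> w)"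
  by (simp add: mult_word_def)

lemma mult_append: "w \<star> (u @ v) = w \<star> (u \<star> v)"
  by (simp add: mult_word_def)

text \<open>These rules associate products to the right, push inverses inwards and cancel adjacent
  inverse pairs, which settles most identities between products below.\<close>

lemmas group_word_simps = mult_word_assoc red_mult_word mult_word_red mult_word_Nil
  inv_word_mult_cancel inv_word_mult inv_word_mult_word red_reduced append_mult mult_append

lemma inv_letter_mult [simp]:
  "[x] \<star> [inv_letter x] = []" "[inv_letter x] \<star> [x] = []"
  "[x] \<star> ([inv_letter x] \<star> v) = red v" "[inv_letter x] \<star> ([x] \<star> v) = red v"
  using inv_word_mult[of "[x]"] inv_word_mult_cancel[of "[x]" v] by simp_all

lemma mult_word_reduced: "reduced (u @ v) \<Longrightarrow> u \<star> v = u @ v"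
  by (simp add: mult_word_def red_reduced)

lemma set_red_subset: "set (red w) \<subseteq> set w"
proof (induction w)
  case (Cons x w)
  then show ?case by (cases "red w") (auto simp: red_Cons)
qed simp

lemma length_red_le: "length (red w) \<le> length w"
proof (induction w)
  case (Cons x w)
  then show ?case by (cases "red w") (auto simp: red_Cons)
qed simp

lemma length_mult_word_le: "length (u \<star> v) \<le> length u + length v"
  using length_red_le[of "u @ v"] by (simp add: mult_word_def)

lemma reduced_words: "w \<in> words B \<Longrightarrow> reduced w"
  by (simp add: words_iff)

lemma red_words: "fst ` set w \<subseteq> B \<Longrightarrow> red w \<in> words B"
  using set_red_subset[of w] by (auto simp: words_iff)

lemma Nil_words [simp]: "[] \<in> words B"
  by (simp add: words_iff)

lemma mult_words [simp]: "u \<in> words B \<Longrightarrow> v \<in> words B \<Longrightarrow> u \<star> v \<in> words B"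
  unfolding mult_word_def by (rule red_words) (auto simp: words_iff)

lemma inv_words [simp]: "inv_word u \<in> words B \<longleftrightarrow> u \<in> words B"
  by (simp add: words_iff)

lemma singleton_words [simp]: "[x] \<in> words B \<longleftrightarrow> fst x \<in> B"
  by (simp add: words_iff)

lemma append_words: "u @ v \<in> words B \<Longrightarrow> u \<in> words B \<and> v \<in> words B"
  by (auto simp: words_iff reduced_append)

lemma group_free_group: "group (free_group B)"
proof (rule groupI)
  fix u assume "u \<in> words B"
  then show "\<exists>v\<in>words B. v \<otimes>\<^bsub>free_group B\<^esub> u = \<one>\<^bsub>free_group B\<^esub>"
    by (intro bexI[of _ "inv_word u"]) (auto simp: inv_word_mult)
qed (auto simp: group_word_simps reduced_words)

lemma inv_free_group: "u \<in> words B \<Longrightarrow> inv\<^bsub>free_group B\<^esub> u = inv_word u"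
  by (rule group.inv_equality[OF group_free_group]) (auto simp: inv_word_mult)

text \<open>Each letter of \<open>v\<close> cancels at most one letter at the end of
  \<open>u\<close>, so a longer \<open>u\<close> keeps its first letter. This later makes colours
  constant far out in the tree.\<close>

lemma hd_mult_word:
  assumes "reduced u" "reduced v" "length v < length u"
  shows "u \<star> v \<noteq> [] \<and> hd (u \<star> v) = hd u"
  using assms
proof (induction v arbitrary: u)
  case Nil
  then show ?case by (auto simp: group_word_simps)
next
  case (Cons y v)
  show ?case
  proof (cases "last u = inv_letter y")
    case True
    from Cons.prems obtain u' where u: "u = u' @ [last u]"
      by (metis append_butlast_last_id length_0_conv not_less_zero)
    then have eq: "u \<star> (y # v) = u' \<star> v"
      using True inv_letter_mult(4)[of y v]
      by (metis append_Cons append_Nil append_mult mult_word_def mult_word_red(1))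
    moreover have "reduced u'" "length v < length u'"
      using Cons.prems u reduced_append[of u' "[last u]"] by (metis, metis Suc_less_eq length_Cons length_append_singleton)
    moreover have "hd u' = hd u"
      using u \<open>length v < length u'\<close> by (metis hd_append2 length_0_conv not_less_zero)
    ultimately show ?thesis using Cons.IH[of u'] Cons.prems
      by (simp add: reduced_Cons)
  next
    case False
    then have "y \<noteq> inv_letter (last u)" by force
    then have "reduced (u @ y # v)"
      using Cons.prems by (auto simp: reduced_append)
    moreover have "u \<noteq> []" using Cons.prems by auto
    ultimately show ?thesis by (simp add: mult_word_reduced)
  qed
qed

section \<open>Paths in the Cayley tree\<close>

text \<open>A set of edges of the Cayley tree is a predicate \<open>E g y\<close>: the edge leaving the vertex \<open>g\<close>
  in direction \<open>y\<close>, which ends at \<open>g \<star> [y]\<close>, belongs to the set.\<close>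

fun path_in :: "('b word \<Rightarrow> 'b letter \<Rightarrow> bool) \<Rightarrow> 'b word \<Rightarrow> 'b word \<Rightarrow> bool" where
  "path_in E p [] = True"
| "path_in E p (y # w) = (E p y \<and> path_in E (p \<star> [y]) w)"

definition edges_sym :: "('b word \<Rightarrow> 'b letter \<Rightarrow> bool) \<Rightarrow> bool" where
  "edges_sym E \<longleftrightarrow> (\<forall>p y. reduced p \<longrightarrow> E p y \<longrightarrow> E (p \<star> [y]) (inv_letter y))"

definition edges_invariant :: "('b word \<Rightarrow> 'b letter \<Rightarrow> bool) \<Rightarrow> 'b word \<Rightarrow> bool" where
  "edges_invariant E h \<longleftrightarrow> (\<forall>p y. reduced p \<longrightarrow> E (h \<star> p) y = E p y)"

lemma edges_symD: "edges_sym E \<Longrightarrow> reduced p \<Longrightarrow> E p y \<Longrightarrow> E (p \<star> [y]) (inv_letter y)"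
  unfolding edges_sym_def by blast

lemma edges_invariantD: "edges_invariant E h \<Longrightarrow> reduced p \<Longrightarrow> E (h \<star> p) y = E p y"
  unfolding edges_invariant_def by blast

lemma mult_Cons_assoc: "p \<star> [y] \<star> w = p \<star> (y # w)"
  by (metis append_Cons append_Nil mult_append mult_word_assoc)

lemma path_in_append:
  "reduced p \<Longrightarrow> path_in E p (u @ v) \<longleftrightarrow> path_in E p u \<and> path_in E (p \<star> u) v"
  by (induction u arbitrary: p) (auto simp: mult_word_Nil red_reduced mult_Cons_assoc)

lemma path_in_nth:
  "reduced p \<Longrightarrow> path_in E p w \<longleftrightarrow> (\<forall>i<length w. E (p \<star> take i w) (w ! i))"
proof (induction w rule: rev_induct)
  case (snoc y w)
  then show ?case by (auto simp: path_in_append nth_append less_Suc_eq)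
qed simp

text \<open>Reduction only removes backtracks, and the edges that remain are edges of the original
  path.\<close>

lemma path_in_red: "reduced p \<Longrightarrow> path_in E p w \<Longrightarrow> path_in E p (red w)"
proof (induction w arbitrary: p)
  case (Cons y w)
  then have IH: "path_in E (p \<star> [y]) (red w)" and "E p y" by auto
  show ?case
  proof (cases "red w")
    case (Cons z v)
    then show ?thesis
      using IH \<open>E p y\<close> \<open>reduced p\<close> by (auto simp: red_Cons group_word_simps)
  qed (use \<open>E p y\<close> in \<open>simp add: red_Cons\<close>)
qed simp

lemma path_in_inv_word:
  "edges_sym E \<Longrightarrow> reduced p \<Longrightarrow> path_in E p w \<Longrightarrow> path_in E (p \<star> w) (inv_word w)"
proof (induction w arbitrary: p)
  case (Cons y w)
  then have "path_in E (p \<star> (y # w)) (inv_word w)"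
    using Cons.IH[of "p \<star> [y]"] by (simp add: mult_Cons_assoc)
  moreover have "p \<star> (y # w) \<star> inv_word w = p \<star> [y]"
    unfolding mult_Cons_assoc[of p y w, symmetric] by (simp add: group_word_simps)
  ultimately show ?case
    using Cons.prems by (simp add: inv_word_Cons path_in_append edges_symD)
qed simp

lemma path_in_translate:
  "edges_invariant E h \<Longrightarrow> reduced p \<Longrightarrow> path_in E (h \<star> p) w = path_in E p w"
  by (induction w arbitrary: p) (auto simp: edges_invariantD mult_word_assoc)

text \<open>If the edge joining the vertex \<open>p\<close> to the tree path towards the cyclically reduced
  conjugate is not in \<open>E\<close>, then nothing cancels in the conjugation and the conjugate is not
  cyclically reduced.\<close>

lemma path_in_cyclically_reduced_conjugate:
  assumes "edges_sym E" "edges_invariant E (p \<star> u \<star> inv_word p)"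
    and "reduced p" "reduced u" "path_in E p u" "reduced z"
    and "z \<star> u \<star> inv_word z = w" "cyclically_reduced w"
  shows "path_in E (p \<star> inv_word z) w"
  using assms(2-)
proof (induction z arbitrary: p u rule: rev_induct)
  case Nil
  then show ?case by (simp add: group_word_simps)
next
  case (snoc a z)
  have pu: "p \<star> u \<star> inv_word p \<star> p = p \<star> u"
    by (simp add: group_word_simps)
  show ?case
  proof (cases "E p (inv_letter a)")
    case True
    \<comment> \<open>Move the base point along \<open>inv_letter a\<close> and conjugate
      \<open>u\<close> by \<open>a\<close>: the element
      \<open>p \<star> u \<star> inv_word p\<close> stays the same, while the conjugator
      \<open>z\<close> loses its last letter.\<close>
    define p1 where "p1 = p \<star> [inv_letter a]"
    define u1 where "u1 = [a] \<star> u \<star> [inv_letter a]"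
    have p1a: "p1 \<star> [a] = p"
      using snoc.prems by (simp add: p1_def group_word_simps)
    have "E (p \<star> u) (inv_letter a)"
      using edges_invariantD[OF snoc.prems(1), of p "inv_letter a"] True snoc.prems pu by simp
    moreover have "E p1 a"
      using edges_symD[OF assms(1) snoc.prems(2) True] by (simp add: p1_def)
    ultimately have "path_in E p1 (a # u @ [inv_letter a])"
      using snoc.prems p1a by (simp add: path_in_append)
    moreover have "u1 = red (a # u @ [inv_letter a])"
      by (simp add: u1_def mult_word_def)
    ultimately have "path_in E p1 u1"
      by (simp add: path_in_red p1_def)
    moreover have "p1 \<star> u1 \<star> inv_word p1 = p \<star> u \<star> inv_word p"
      by (simp add: p1_def u1_def group_word_simps)
    moreover have "z \<star> u1 \<star> inv_word z = w"
      using snoc.prems(6) by (simp add: u1_def group_word_simps del: append_Cons)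
    moreover have "reduced z" "reduced p1" "reduced u1"
      using snoc.prems by (auto simp: p1_def u1_def reduced_append)
    ultimately have "path_in E (p1 \<star> inv_word z) w"
      using snoc.IH[of p1 u1] snoc.prems by simp
    then show ?thesis by (simp add: p1_def group_word_simps del: append_Cons)
  next
    case False
    have "u \<noteq> []"
      using snoc.prems(6,7)
      by (auto simp: group_word_simps cyclically_reduced_def simp del: append_Cons)
    moreover have "hd u \<noteq> inv_letter a"
      using False snoc.prems(4) \<open>u \<noteq> []\<close> by (cases u) auto
    moreover have "last u \<noteq> a"
    \<comment> \<open>If \<open>u\<close> ended in \<open>a\<close>, the reverse of its last edge
      would be the translate of the missing edge at \<open>p\<close> by an element that preserves
      \<open>E\<close>.\<close>
    proof
      assume "last u = a"
      then obtain v where u: "u = v @ [a]"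
        using \<open>u \<noteq> []\<close> by (metis append_butlast_last_id)
      then have "E (p \<star> v) a"
        using snoc.prems by (simp add: path_in_append)
      then have "E (p \<star> u) (inv_letter a)"
        using edges_symD[OF assms(1), of "p \<star> v" a] by (simp add: u group_word_simps)
      then show False
        using edges_invariantD[OF snoc.prems(1), of p "inv_letter a"] False snoc.prems pu by simp
    qed
    moreover have "last (z @ [a]) = a" "inv_word (z @ [a]) = inv_letter a # inv_word z"
      by simp_all
    ultimately have "reduced ((z @ [a]) @ (u @ inv_word (z @ [a])))"
      using snoc.prems(3,5) reduced_inv_word[of "z @ [a]"]
      by (auto simp: reduced_append reduced_Cons simp del: reduced_inv_word inv_word_append)
    then have "w = (z @ [a]) @ u @ inv_word (z @ [a])"
      using snoc.prems(6) by (metis mult_word_def mult_word_red(1) red_append_red red_reduced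
          mult_word_assoc)
    then have "hd w = hd (z @ [a])" "last w = inv_letter (hd (z @ [a]))"
      using last_inv_word[of "z @ [a]"] by (simp_all del: inv_word_append add: hd_append)
    then show ?thesis
      using snoc.prems(7) by (simp add: cyclically_reduced_def)
  qed
qed

section \<open>The core\<close>

text \<open>This is the preimage of the core in the Cayley tree: the edge leaving \<open>g\<close>
  in direction \<open>y\<close> projects to a core edge. Loops can be rotated, so \<open>w\<close>
  may start with that edge and no position inside the loop is needed.\<close>

definition core_dir :: "'b set \<Rightarrow> 'b word set \<Rightarrow> 'b word \<Rightarrow> 'b letter \<Rightarrow> bool" where
  "core_dir B H g y \<longleftrightarrow> g \<in> words B \<and>
     (\<exists>w. cyclically_reduced w \<and> hd w = y \<and> g \<star> w \<star> inv_word g \<in> H)"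

lemma subgroup_mult: "subgroup H (free_group B) \<Longrightarrow> h \<in> H \<Longrightarrow> k \<in> H \<Longrightarrow> h \<star> k \<in> H"
  using subgroup.m_closed[of H "free_group B"] by simp

lemma subgroup_inv_word: "subgroup H (free_group B) \<Longrightarrow> h \<in> H \<Longrightarrow> inv_word h \<in> H"
  by (metis inv_free_group subgroup.m_inv_closed subgroup.mem_carrier)

lemma subgroup_words: "subgroup H (free_group B) \<Longrightarrow> h \<in> H \<Longrightarrow> h \<in> words B"
  by (rule subgroup.mem_carrier)

lemma cyclically_reduced_rotate: "cyclically_reduced (u @ v) \<Longrightarrow> cyclically_reduced (v @ u)"
  by (cases "u = []"; cases "v = []") (auto simp: cyclically_reduced_def reduced_append)

lemma cyclically_reduced_inv_word: "cyclically_reduced w \<Longrightarrow> cyclically_reduced (inv_word w)"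
  by (auto simp: cyclically_reduced_def hd_inv_word last_inv_word)

lemma core_dir_words: "core_dir B H g y \<Longrightarrow> g \<in> words B"
  by (simp add: core_dir_def)

lemma edges_invariant_core_dir:
  assumes "subgroup H (free_group B)" "h \<in> H"
  shows "edges_invariant (core_dir B H) h"
proof -
  have 1: "core_dir B H (h \<star> p) y" if "core_dir B H p y" "h \<in> H" for p y h
  proof -
    from that obtain w where w: "cyclically_reduced w" "hd w = y" "p \<star> w \<star> inv_word p \<in> H"
      and p: "p \<in> words B"
      by (auto simp: core_dir_def)
    have "h \<star> (p \<star> w \<star> inv_word p) \<star> inv_word h \<in> H"
      by (intro subgroup_mult[OF assms(1)] subgroup_inv_word[OF assms(1)] w that)
    then have "(h \<star> p) \<star> w \<star> inv_word (h \<star> p) \<in> H"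
      by (simp add: group_word_simps)
    then show ?thesis
      using w p that subgroup_words[OF assms(1)] mult_words unfolding core_dir_def by blast
  qed
  have "core_dir B H p y" if "core_dir B H (h \<star> p) y" "reduced p" for p y
    using 1[OF that(1) subgroup_inv_word[OF assms]] that by (simp add: group_word_simps)
  then show ?thesis
    using 1 assms(2) unfolding edges_invariant_def by blast
qed

text \<open>The definition of \<open>core_dir\<close> does not restrict the letters of
  \<open>w\<close>; conjugating the element of \<open>H\<close> back by \<open>g\<close> returns
  \<open>w\<close> itself, which is already reduced.\<close>

lemma loop_words:
  assumes "subgroup H (free_group B)" "g \<in> words B" "cyclically_reduced w"
    and "g \<star> w \<star> inv_word g \<in> H"
  shows "w \<in> words B"
proof -
  have "inv_word g \<star> (g \<star> w \<star> inv_word g) \<star> g \<in> words B"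
    by (intro mult_words subgroup_words[OF assms(1) assms(4)]) (simp_all add: assms(2))
  then show ?thesis
    using assms(3) by (simp add: group_word_simps cyclically_reduced_def)
qed

lemma core_dir_label:
  assumes "core_dir B H g y" "subgroup H (free_group B)"
  shows "fst y \<in> B"
proof -
  obtain w where w: "cyclically_reduced w" "hd w = y" "g \<star> w \<star> inv_word g \<in> H"
    and g: "g \<in> words B"
    using assms(1) by (auto simp: core_dir_def)
  have "w \<in> words B"
    using loop_words[OF assms(2) g w(1,3)] .
  then show ?thesis
    using w by (auto simp: words_iff cyclically_reduced_def)
qed

lemma edges_sym_core_dir:
  assumes "subgroup H (free_group B)"
  shows "edges_sym (core_dir B H)"
  unfolding edges_sym_def
proof (intro allI impI)
  fix p y assume c: "core_dir B H p y"
  then obtain w where w: "cyclically_reduced w" "hd w = y" "p \<star> w \<star> inv_word p \<in> H"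
      and p: "p \<in> words B"
      by (auto simp: core_dir_def)
  then obtain s where s: "w = [y] @ s"
    by (cases w) (auto simp: cyclically_reduced_def)
  \<comment> \<open>Rotating \<open>w\<close> past its first letter gives a loop at
    \<open>p \<star> [y]\<close> that ends in \<open>y\<close>; its reverse starts with the inverse
    of \<open>y\<close>.\<close>
  define v where "v = inv_word (s @ [y])"
  have "cyclically_reduced v"
    unfolding v_def using w s by (metis cyclically_reduced_inv_word cyclically_reduced_rotate)
  moreover have "hd v = inv_letter y"
    by (simp add: v_def)
  moreover have "(p \<star> [y]) \<star> v \<star> inv_word (p \<star> [y]) = inv_word (p \<star> w \<star> inv_word p)"
    unfolding s v_def by (simp only: inv_word_append) (simp add: group_word_simps del: append_Cons)
  ultimately show "core_dir B H (p \<star> [y]) (inv_letter y)"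
    using w p core_dir_label[OF c assms] subgroup_inv_word[OF assms w(3)] mult_words[OF p, of "[y]"]
    unfolding core_dir_def by auto
qed

text \<open>Each rotation of the loop is a loop at the vertex reached there, so every edge passed is
  the first edge of a loop.\<close>

lemma path_in_core:
  assumes "subgroup H (free_group B)" "g \<in> words B" "cyclically_reduced w"
    and "g \<star> w \<star> inv_word g \<in> H"
  shows "path_in (core_dir B H) g w"
proof -
  have w: "w \<in> words B"
    using loop_words[OF assms] .
  have "core_dir B H (g \<star> take i w) (w ! i)" if "i < length w" for i
  proof -
    define u v where "u = take i w" and "v = drop i w"
    have uv: "w = u @ v" by (simp add: u_def v_def)
    have "cyclically_reduced (v @ u)"
      using assms uv by (metis cyclically_reduced_rotate)
    moreover have "hd (v @ u) = w ! i"
      using that by (simp add: v_def hd_drop_conv_nth)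
    moreover have "(g \<star> u) \<star> (v @ u) \<star> inv_word (g \<star> u) = g \<star> w \<star> inv_word g"
      unfolding uv by (simp add: group_word_simps)
    moreover have "g \<star> u \<in> words B"
      using assms w append_words[of u v B] by (simp add: uv)
    ultimately show ?thesis
      using assms(4) unfolding core_dir_def u_def[symmetric] by metis
  qed
  then show ?thesis
    using path_in_nth[OF reduced_words[OF assms(2)]] by blast
qed

text \<open>Passes from cosets to vertices of the tree. An edge traversed against its orientation is
  replaced by its reverse, so every core edge is recorded with a letter
  \<open>(b, False)\<close>.\<close>

lemma core_edges_eq:
  assumes "subgroup H (free_group B)"
  shows "core_edges B H =
    {(r_coset (free_group B) H g, b) |g b. core_dir B H g (b, False)}"
    (is "_ = ?R")
proof
  interpret group "free_group B" by (rule group_free_group)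
  have closed: "r_coset (free_group B) H (g \<star> w) = r_coset (free_group B) H g \<longleftrightarrow>
      g \<star> w \<star> inv_word g \<in> H" if "g \<in> words B" "w \<in> words B" for g w
  proof
    assume "r_coset (free_group B) H (g \<star> w) = r_coset (free_group B) H g"
    then have "g \<star> w \<in> r_coset (free_group B) H g"
      using rcos_self[OF mult_words[OF that] assms] by simp
    then obtain h where "h \<in> H" "g \<star> w = h \<star> g"
      by (auto simp: r_coset_def)
    moreover from this have "g \<star> w \<star> inv_word g = h"
      using reduced_words[OF subgroup_words[OF assms \<open>h \<in> H\<close>]] by (simp add: group_word_simps)
    ultimately show "g \<star> w \<star> inv_word g \<in> H"
      by simp
  next
    assume *: "g \<star> w \<star> inv_word g \<in> H"
    have "g \<star> w = (g \<star> w \<star> inv_word g) \<star> g"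
      by (simp add: group_word_simps)
    then have "g \<star> w \<in> r_coset (free_group B) H g"
      using * unfolding r_coset_def mult_free_group by blast
    then show "r_coset (free_group B) H (g \<star> w) = r_coset (free_group B) H g"
      using repr_independence[OF _ that(1) assms] by auto
  qed
  show "core_edges B H \<subseteq> ?R"
  proof
    fix e assume "e \<in> core_edges B H"
    then obtain g w i where g: "g \<in> words B" "w \<in> words B" "cyclically_reduced w"
        "r_coset (free_group B) H (g \<star> w) = r_coset (free_group B) H g" "i < length w"
      and e: "e = (if snd (w ! i)
                 then (r_coset (free_group B) H (g \<star> take (Suc i) w), fst (w ! i))
                 else (r_coset (free_group B) H (g \<star> take i w), fst (w ! i)))"
      by (auto simp: core_edges_def)
    have "path_in (core_dir B H) g w"
      using path_in_core[OF assms g(1,3)] closed g by auto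
    then have d: "core_dir B H (g \<star> take i w) (w ! i)"
      using g(5) path_in_nth[OF reduced_words[OF g(1)]] by blast
    have "g \<star> take i w \<star> [w ! i] = g \<star> take (Suc i) w"
      using g(5) by (simp add: take_Suc_conv_app_nth group_word_simps)
    then have "core_dir B H (g \<star> take (Suc i) w) (inv_letter (w ! i))"
      using edges_symD[OF edges_sym_core_dir[OF assms] _ d] by simp
    moreover have "(fst (w ! i), False) = (if snd (w ! i) then inv_letter (w ! i) else w ! i)"
      by (simp add: inv_letter_def prod_eq_iff)
    ultimately show "e \<in> ?R"
      using d unfolding e by (cases "snd (w ! i)") auto
  qed
  show "?R \<subseteq> core_edges B H"
  proof clarify
    fix g b assume d: "core_dir B H g (b, False)"
    then obtain w where w: "cyclically_reduced w" "hd w = (b, False)" "g \<star> w \<star> inv_word g \<in> H"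
      and g: "g \<in> words B"
      by (auto simp: core_dir_def)
    have "w \<in> words B"
      using loop_words[OF assms g w(1,3)] .
    moreover have "r_coset (free_group B) H (g \<star> w) = r_coset (free_group B) H g"
      using closed[OF g \<open>w \<in> words B\<close>] w by simp
    moreover have "0 < length w" "w ! 0 = (b, False)"
      using w by (auto simp: cyclically_reduced_def hd_conv_nth)
    moreover have "g \<star> take 0 w = g"
      using reduced_words[OF g] by (simp add: group_word_simps)
    ultimately show "(r_coset (free_group B) H g, b) \<in> core_edges B H"
      using w(1) g unfolding core_edges_def mult_free_group mem_Collect_eq
      by (intro exI[of _ g] exI[of _ w] exI[of _ 0]) simp
  qed
qed

lemma core_labels_iff:
  assumes "subgroup H (free_group B)"
  shows "core_labels B H = {fst y |g y. core_dir B H g y}"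
proof -
  have *: "\<exists>g'. core_dir B H g' (fst y, False)" if "core_dir B H g y" for g y
  proof (cases "snd y")
    case True
    then have "inv_letter y = (fst y, False)" by (simp add: inv_letter_def)
    then show ?thesis
      using edges_symD[OF edges_sym_core_dir[OF assms] reduced_words[OF core_dir_words[OF that]] that]
      by metis
  qed (use that in \<open>metis (full_types) prod.collapse\<close>)
  have "core_labels B H = {b. \<exists>g. core_dir B H g (b, False)}"
    unfolding core_labels_def core_edges_eq[OF assms] by (auto simp: image_iff)
  also have "\<dots> = {fst y |g y. core_dir B H g y}"
  proof
    show "{b. \<exists>g. core_dir B H g (b, False)} \<subseteq> {fst y |g y. core_dir B H g y}"
      by force
  qed (use * in blast)
  finally show ?thesis .
qed

lemma core_dir_loop:
  assumes "subgroup H (free_group B)" "g \<in> words B" "cyclically_reduced w"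
    and "g \<star> w \<star> inv_word g \<in> H"
  shows "core_dir B H g (hd w)" "core_dir B H g (inv_letter (last w))"
proof -
  show "core_dir B H g (hd w)"
    using assms unfolding core_dir_def by blast
  have "g \<star> inv_word w \<star> inv_word g = inv_word (g \<star> w \<star> inv_word g)"
    by (simp add: group_word_simps)
  then have "g \<star> inv_word w \<star> inv_word g \<in> H"
    using assms(1,4) subgroup_inv_word by metis
  moreover have "hd (inv_word w) = inv_letter (last w)"
    using assms(3) by (simp add: cyclically_reduced_def hd_inv_word)
  ultimately show "core_dir B H g (inv_letter (last w))"
    using assms(2) cyclically_reduced_inv_word[OF assms(3)] unfolding core_dir_def by metis
qed

text \<open>The core has no vertex of valence one: a cyclically reduced loop leaves \<open>g\<close>
  in one direction and returns through another.\<close>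

lemma core_dir_two:
  assumes "subgroup H (free_group B)" "core_dir B H g y"
  obtains y' where "core_dir B H g y'" "y' \<noteq> y"
proof -
  obtain w where w: "cyclically_reduced w" "hd w = y" "g \<star> w \<star> inv_word g \<in> H"
    using assms(2) by (auto simp: core_dir_def)
  have "inv_letter (last w) \<noteq> y"
    using w by (metis cyclically_reduced_def inv_letter_inv_letter)
  then show ?thesis
    using that core_dir_loop(2)[OF assms(1) core_dir_words[OF assms(2)] w(1,3)] by blast
qed

text \<open>Two loops at \<open>g\<close> and \<open>g \<star> p\<close>, neither of which runs into \<open>p\<close>, combine with \<open>p\<close> to a
  cyclically reduced loop through \<open>p\<close>.\<close>

lemma core_connected:
  assumes "subgroup H (free_group B)" "reduced p" "core_dir B H g y" "core_dir B H (g \<star> p) y'"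
  shows "path_in (core_dir B H) g p"
  using assms(2-)
proof (induction "length p" arbitrary: p g y y' rule: less_induct)
  case less
  note sym = edges_symD[OF edges_sym_core_dir[OF assms(1)]]
  have g: "g \<in> words B" "g \<star> p \<in> words B" "reduced g"
    using less.prems core_dir_words reduced_words by blast+
  show ?case
  proof (cases "p = []")
    case False
    then obtain a q where p1: "p = a # q" by (cases p) auto
    obtain r b where p2: "p = r @ [b]" using False by (metis append_butlast_last_id)
    have red: "reduced q" "reduced r"
      using less.prems(1) reduced_append[of "[a]" q] reduced_append[of r "[b]"] p1 p2 by auto
    \<comment> \<open>If the first or the last edge of \<open>p\<close> is already a core edge,
      induction applies to the rest of \<open>p\<close>; only otherwise are the two loops
      combined.\<close>
    show ?thesis
    proof (cases "core_dir B H g a \<or> core_dir B H (g \<star> p) (inv_letter b)")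
      case True
      then show ?thesis
      proof
        assume a: "core_dir B H g a"
        have "path_in (core_dir B H) (g \<star> [a]) q"
        proof (rule less.hyps)
          show "length q < length p" by (simp add: p1)
          show "core_dir B H (g \<star> [a]) (inv_letter a)" using sym[OF g(3) a] .
          show "core_dir B H (g \<star> [a] \<star> q) y'"
            using less.prems(3) by (simp add: p1 mult_Cons_assoc)
        qed (rule red)
        then show ?thesis using a by (simp add: p1)
      next
        assume b: "core_dir B H (g \<star> p) (inv_letter b)"
        have "g \<star> p \<star> [inv_letter b] = g \<star> r"
          by (simp add: p2 group_word_simps)
        then have b': "core_dir B H (g \<star> r) b"
          using sym[OF _ b] by simp
        have "path_in (core_dir B H) g r"
          by (rule less.hyps[OF _ red(2) less.prems(2) b']) (simp add: p2)
        then show ?thesis using b' g by (simp add: p2 path_in_append)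
      qed
    next
      case no: False
      obtain w where w: "cyclically_reduced w" "g \<star> w \<star> inv_word g \<in> H"
        using less.prems(2) unfolding core_dir_def by blast
      obtain v where v: "cyclically_reduced v" "(g \<star> p) \<star> v \<star> inv_word (g \<star> p) \<in> H"
        using less.prems(3) unfolding core_dir_def by blast
      define u where "u = p @ v @ inv_word p @ w"
      have "a \<noteq> hd w" "a \<noteq> inv_letter (last w)"
        using no core_dir_loop[OF assms(1) g(1) w] by auto
      moreover have "inv_letter b \<noteq> hd v" "inv_letter b \<noteq> inv_letter (last v)"
        using no core_dir_loop[OF assms(1) g(2) v] by auto
      moreover have "hd p = a" "last p = b" by (simp add: p1, simp add: p2)
      ultimately have "cyclically_reduced u"
        using w(1) v(1) less.prems(1) False
        by (auto simp: u_def cyclically_reduced_def reduced_append hd_inv_word last_inv_word)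
      moreover have "g \<star> u \<star> inv_word g
          = ((g \<star> p) \<star> v \<star> inv_word (g \<star> p)) \<star> (g \<star> w \<star> inv_word g)"
        by (simp add: u_def group_word_simps)
      then have "g \<star> u \<star> inv_word g \<in> H"
        using subgroup_mult[OF assms(1) v(2) w(2)] by metis
      ultimately have "path_in (core_dir B H) g u"
        using path_in_core[OF assms(1) g(1)] by blast
      then show ?thesis
        using g(3) by (simp add: u_def path_in_append)
    qed
  qed simp
qed

section \<open>Conjugation into free factors and finiteness of the core\<close>

lemma path_in_labels: "path_in E p w \<Longrightarrow> (\<And>p y. E p y \<Longrightarrow> fst y \<in> B) \<Longrightarrow> fst ` set w \<subseteq> B"
  by (induction w arbitrary: p) auto

text \<open>The element \<open>h\<close> moves the core vertex \<open>g\<close> to the core vertex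
  \<open>h \<star> g\<close>. By connectedness the tree path between them, which reads
  \<open>inv_word g \<star> h \<star> g\<close>, stays in the core and uses only its labels.\<close>

lemma subgroup_conjugate_into_factor:
  assumes "subgroup H (free_group B)" "core_labels B H \<subseteq> C" "core_dir B H g y" "h \<in> H"
  shows "inv_word g \<star> h \<star> g \<in> words C"
proof -
  have g: "reduced g"
    using assms(3) core_dir_words reduced_words by blast
  have "core_dir B H (h \<star> g) y"
    using edges_invariantD[OF edges_invariant_core_dir[OF assms(1,4)] g] assms(3) by blast
  moreover have "g \<star> (inv_word g \<star> h \<star> g) = h \<star> g"
    by (simp add: group_word_simps)
  ultimately have "path_in (core_dir B H) g (inv_word g \<star> h \<star> g)"
    using core_connected[OF assms(1) _ assms(3)] reduced_mult_word by metis
  moreover have "fst y \<in> C" if "core_dir B H p y" for p y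
    using that assms(2) unfolding core_labels_iff[OF assms(1)] by blast
  ultimately have "fst ` set (inv_word g \<star> h \<star> g) \<subseteq> C"
    using path_in_labels by blast
  then show ?thesis by (simp add: words_iff)
qed

text \<open>Peel off the first and the last letter while they are inverse to each other; in a
  nonempty reduced word this never exhausts the word.\<close>

lemma conjugate_cyclically_reduced:
  assumes "h \<in> words B" "h \<noteq> []"
  obtains z w where "z \<in> words B" "cyclically_reduced w" "h = z \<star> w \<star> inv_word z"
proof -
  have "\<exists>z\<in>words B. \<exists>w. cyclically_reduced w \<and> h = z \<star> w \<star> inv_word z"
    using assms
  proof (induction "length h" arbitrary: h rule: less_induct)
    case less
    show ?case
    proof (cases "cyclically_reduced h")
      case True
      then show ?thesis
        using less.prems by (intro bexI[of _ "[]"] exI[of _ h])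
          (auto simp: group_word_simps reduced_words)
    next
      case False
      obtain a u where h: "h = a # u" using less.prems by (cases h) auto
      have last: "last h = inv_letter a"
        using False less.prems by (simp add: cyclically_reduced_def h words_iff)
      then have "u \<noteq> []" using h by auto
      then obtain v where v: "u = v @ [inv_letter a]"
        using h last by (metis append_butlast_last_id last_ConsR)
      have h': "h = [a] @ v @ [inv_letter a]" by (simp add: h v)
      then have vB: "v \<in> words B" "fst a \<in> B" "v \<noteq> []"
        using less.prems by (auto simp: words_iff reduced_append reduced_Cons)
      obtain z w where zw: "z \<in> words B" "cyclically_reduced w" "v = z \<star> w \<star> inv_word z"
        using less.hyps[of v] vB by (auto simp: h')
      have "h = red h"
        using less.prems by (simp add: words_iff red_reduced)
      also have "\<dots> = [a] \<star> v \<star> [inv_letter a]"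
        by (simp add: h' mult_word_def)
      also have "\<dots> = ([a] \<star> z) \<star> w \<star> inv_word ([a] \<star> z)"
        by (simp add: zw(3) group_word_simps)
      finally have "h = ([a] \<star> z) \<star> w \<star> inv_word ([a] \<star> z)" .
      moreover have "[a] \<star> z \<in> words B"
        using zw(1) vB by simp
      ultimately show ?thesis
        using zw(2) by blast
    qed
  qed
  then show ?thesis using that by blast
qed

text \<open>The \<open>H\<close>-translates of the paths from the identity that read the generators
  cover the core, and modulo \<open>H\<close> they have finitely many edges. Without finiteness,
  \<open>card\<close> would say nothing about the size of the core.\<close>

lemma finite_core_edges:
  assumes "fin_gen_subgroup B H"
  shows "finite (core_edges B H)"
proof -
  obtain S where S: "finite S" "S \<subseteq> words B" "H = generate (free_group B) S"
    and H: "subgroup H (free_group B)"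
    using assms unfolding fin_gen_subgroup_def by blast
  \<comment> \<open>The second alternative adds the reversed edges, which makes \<open>E\<close>
    symmetric.\<close>
  define E where "E g y \<longleftrightarrow> (\<exists>s\<in>S. \<exists>i<length s. \<exists>h\<in>H.
      g = h \<star> take i s \<and> y = s ! i \<or> g = h \<star> take (Suc i) s \<and> y = inv_letter (s ! i))" for g y
  have step: "h \<star> take i s \<star> [s ! i] = h \<star> take (Suc i) s" if "i < length s" for h s i
    using that by (simp add: take_Suc_conv_app_nth group_word_simps)
  have sym: "edges_sym E"
    unfolding edges_sym_def
  proof (intro allI impI)
    fix p y assume "E p y"
    then obtain s i h where s: "s \<in> S" "i < length s" "h \<in> H"
      and "p = h \<star> take i s \<and> y = s ! i \<or> p = h \<star> take (Suc i) s \<and> y = inv_letter (s ! i)"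
      unfolding E_def by blast
    from this(4) show "E (p \<star> [y]) (inv_letter y)"
    proof
      assume "p = h \<star> take i s \<and> y = s ! i"
      then show ?thesis using s step[of i s h] unfolding E_def by blast
    next
      assume py: "p = h \<star> take (Suc i) s \<and> y = inv_letter (s ! i)"
      then have "p \<star> [y] = h \<star> take i s"
        using step[OF s(2), of h, symmetric] by (simp add: group_word_simps)
      then show ?thesis using s py unfolding E_def by auto
    qed
  qed
  have translate: "E (h \<star> p) y" if "E p y" "h \<in> H" for h p y
    using that subgroup_mult[OF H] unfolding E_def by (metis mult_word_assoc)
  have invar: "edges_invariant E h" if "h \<in> H" for h
    unfolding edges_invariant_def
  proof (intro allI impI iffI)
    fix p y assume "reduced p" "E (h \<star> p) y"
    then show "E p y"
      using translate[OF _ subgroup_inv_word[OF H that], of "h \<star> p" y]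
      by (simp add: group_word_simps)
  qed (use translate that in blast)
  \<comment> \<open>By induction on products of generators, \<open>E\<close> contains a path from
    the identity to every element of \<open>H\<close>; invariance moves the second factor to the end
    of the first.\<close>
  have gen: "h \<in> H \<and> path_in E [] h" if "h \<in> generate (free_group B) S" for h
    using that
  proof induction
    case one
    then show ?case using subgroup.one_closed[OF H] by simp
  next
    case (incl s)
    have "E ([] \<star> take i s) (s ! i)" if "i < length s" for i
      using that incl subgroup.one_closed[OF H] unfolding E_def by auto
    moreover have "s \<in> H" using incl S(3) generate.incl by metis
    ultimately show ?case by (simp add: path_in_nth)
  next
    case (inv s)
    have "E ([] \<star> take i s) (s ! i)" if "i < length s" for i
      using that inv subgroup.one_closed[OF H] unfolding E_def by auto
    then have "path_in E [] s" by (simp add: path_in_nth)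
    then have "path_in E ([] \<star> s) (inv_word s)"
      using path_in_inv_word[OF sym] by simp
    moreover have s: "s \<in> H" "s \<in> words B" using inv S(2,3) generate.incl by (metis, blast)
    moreover have "[] \<star> s = s \<star> []" by (simp add: mult_word_Nil)
    ultimately have "path_in E [] (inv_word s)"
      using path_in_translate[OF invar[OF s(1)], of "[]"] by simp
    then show ?case
      using s subgroup_inv_word[OF H] by (simp add: inv_free_group)
  next
    case (eng h k)
    have "path_in E (h \<star> []) k"
      using path_in_translate[of E h "[]" k] eng invar by simp
    moreover have "h \<star> [] = [] \<star> h" by (simp add: mult_word_Nil)
    ultimately have "path_in E [] (h @ k)"
      using eng by (simp add: path_in_append)
    then have "path_in E [] (h \<star> k)"
      unfolding mult_word_def by (simp add: path_in_red)
    then show ?case using eng subgroup_mult[OF H] by simp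
  qed
  have core: "E g y" if "core_dir B H g y" for g y
  proof -
    obtain w where w: "cyclically_reduced w" "hd w = y" "g \<star> w \<star> inv_word g \<in> H"
      and g: "reduced g"
      using \<open>core_dir B H g y\<close> reduced_words unfolding core_dir_def by blast
    define h where "h = g \<star> w \<star> inv_word g"
    \<comment> \<open>The base point is the identity and the conjugator is
      \<open>inv_word g\<close>, which turns \<open>h\<close> into the loop \<open>w\<close>; hence
      \<open>E\<close> contains the loop at \<open>g\<close>.\<close>
    have "path_in E ([] \<star> inv_word (inv_word g)) w"
    proof (rule path_in_cyclically_reduced_conjugate[OF sym])
      show "edges_invariant E ([] \<star> h \<star> inv_word [])"
        using invar w(3) by (simp add: h_def group_word_simps)
      show "path_in E [] h" using gen w(3) S(3) by (simp add: h_def)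
      show "inv_word g \<star> h \<star> inv_word (inv_word g) = w"
        using w(1) by (simp add: h_def group_word_simps cyclically_reduced_def)
    qed (use w g in \<open>auto simp: h_def\<close>)
    then have "path_in E g w" using g by (simp add: group_word_simps)
    then show ?thesis
      using w by (cases w) (auto simp: cyclically_reduced_def)
  qed
  have "core_edges B H \<subseteq> (\<Union>s\<in>S. \<Union>i<length s.
      {(r_coset (free_group B) H (take i s), fst (s ! i)),
       (r_coset (free_group B) H (take (Suc i) s), fst (s ! i))})"
  proof
    fix e assume "e \<in> core_edges B H"
    then obtain g b where e: "e = (r_coset (free_group B) H g, b)" "core_dir B H g (b, False)"
      unfolding core_edges_eq[OF H] by blast
    from core[OF this(2)] obtain s i h where s: "s \<in> S" "i < length s" "h \<in> H"
      and g: "g = h \<star> take i s \<and> (b, False) = s ! i \<or>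
        g = h \<star> take (Suc i) s \<and> (b, False) = inv_letter (s ! i)"
      unfolding E_def by blast
    have b: "b = fst (s ! i)" using g by (metis fst_conv fst_inv_letter)
    have "r_coset (free_group B) H (h \<star> take j s) = r_coset (free_group B) H (take j s)" for j
    proof -
      interpret group "free_group B" by (rule group_free_group)
      have "take j s \<in> words B"
        using S(2) s(1) append_words[of "take j s" "drop j s" B] by auto
      then show ?thesis
        using coset_mult_assoc[of H h "take j s"] coset_join2[OF _ H s(3)] s(3)
          subgroup_words[OF H] subgroup.subset[OF H] by (simp add: subsetD)
    qed
    then have "e = (r_coset (free_group B) H (take i s), fst (s ! i)) \<or>
        e = (r_coset (free_group B) H (take (Suc i) s), fst (s ! i))"
      using g e b by auto
    then show "e \<in> (\<Union>s\<in>S. \<Union>i<length s.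
      {(r_coset (free_group B) H (take i s), fst (s ! i)),
       (r_coset (free_group B) H (take (Suc i) s), fst (s ! i))})"
      using s by blast
  qed
  then show ?thesis
    by (rule finite_subset) (use S(1) in auto)
qed

section \<open>Automorphisms\<close>

lemma Aut_words: "\<alpha> \<in> Aut_F B \<Longrightarrow> u \<in> words B \<Longrightarrow> \<alpha> u \<in> words B"
  by (auto simp: Aut_F_def iso_def hom_def)

lemma Aut_mult: "\<alpha> \<in> Aut_F B \<Longrightarrow> u \<in> words B \<Longrightarrow> v \<in> words B \<Longrightarrow> \<alpha> (u \<star> v) = \<alpha> u \<star> \<alpha> v"
  by (auto simp: Aut_F_def iso_def hom_def)

lemma Aut_group_hom: "\<alpha> \<in> Aut_F B \<Longrightarrow> group_hom (free_group B) (free_group B) \<alpha>"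
  by (simp add: Aut_F_def iso_def group_hom_def group_hom_axioms_def group_free_group)

lemma Aut_Nil: "\<alpha> \<in> Aut_F B \<Longrightarrow> \<alpha> [] = []"
  using group_hom.hom_one[OF Aut_group_hom, of \<alpha> B] by simp

lemma Aut_bij: "\<alpha> \<in> Aut_F B \<Longrightarrow> bij_betw \<alpha> (words B) (words B)"
  by (simp add: Aut_F_def iso_def)

lemma Aut_inj: "\<alpha> \<in> Aut_F B \<Longrightarrow> inj_on \<alpha> (words B)"
  using Aut_bij bij_betw_def by blast

lemma Aut_subgroup:
  "\<alpha> \<in> Aut_F B \<Longrightarrow> subgroup H (free_group B) \<Longrightarrow> subgroup (\<alpha> ` H) (free_group B)"
  by (rule group_hom.subgroup_img_is_subgroup[OF Aut_group_hom])

lemma Aut_inv_into: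
  assumes "\<alpha> \<in> Aut_F B"
  shows "inv_into (words B) \<alpha> \<in> Aut_F B"
  using group.iso_set_sym[OF group_free_group] assms unfolding Aut_F_def by blast

lemma finite_short_words:
  assumes "finite B"
  shows "finite {w \<in> words B. length w < M}"
proof (rule finite_subset)
  show "{w \<in> words B. length w < M} \<subseteq> {w. set w \<subseteq> B \<times> UNIV \<and> length w \<le> M}"
    by (force simp: words_iff)
  show "finite {w. set w \<subseteq> B \<times> (UNIV :: bool set) \<and> length w \<le> M}"
    using assms by (intro finite_lists_length_le) auto
qed

text \<open>There are finitely many words shorter than \<open>M\<close>, and by injectivity finitely
  many elements are mapped to them.\<close>

lemma Aut_length_unbounded:
  assumes "finite B" "\<alpha> \<in> Aut_F B"
  shows "\<exists>N. \<forall>g\<in>words B. N \<le> length g \<longrightarrow> M \<le> length (\<alpha> g)"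
proof -
  let ?S = "{g \<in> words B. length (\<alpha> g) < M}"
  have "finite ?S"
  proof (rule inj_on_finite)
    show "inj_on \<alpha> ?S"
      using Aut_inj[OF assms(2)] by (rule inj_on_subset) blast
    show "\<alpha> ` ?S \<subseteq> {w \<in> words B. length w < M}"
      using Aut_words[OF assms(2)] by blast
  qed (rule finite_short_words[OF assms(1)])
  then have "finite (length ` ?S)" by simp
  then obtain N where "\<forall>n\<in>length ` ?S. n < N"
    using finite_nat_set_iff_bounded by blast
  then show ?thesis
    by (intro exI[of _ N]) (force simp: not_le[symmetric])
qed

section \<open>The cut vertex\<close>

text \<open>Plain concatenation: for cyclically reduced \<open>w\<close> nothing cancels, and the
  powers run along a ray to an end of the Cayley tree.\<close>

abbreviation word_power :: "'b word \<Rightarrow> nat \<Rightarrow> 'b word" where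
  "word_power w n \<equiv> concat (replicate n w)"

lemma word_power_neq_Nil: "w \<noteq> [] \<Longrightarrow> n > 0 \<Longrightarrow> word_power w n \<noteq> [] \<and> hd (word_power w n) = hd w"
  by (cases n) auto

lemma length_word_power: "w \<noteq> [] \<Longrightarrow> n \<le> length (word_power w n)"
proof (induction n)
  case (Suc n)
  then show ?case by (cases w) auto
qed simp

lemma reduced_word_power:
  assumes "cyclically_reduced w"
  shows "reduced (word_power w n)"
proof (induction n)
  case (Suc n)
  moreover have "hd w \<noteq> inv_letter (last w)"
    using assms by (metis cyclically_reduced_def inv_letter_inv_letter)
  ultimately show ?case
    using assms word_power_neq_Nil[of w n]
    by (cases "n = 0") (auto simp: reduced_append cyclically_reduced_def)
qed simp

lemma reduced_append_word_power:
  assumes "cyclically_reduced w" "reduced (v @ w)"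
  shows "reduced (v @ word_power w n)"
  using assms reduced_word_power[OF assms(1), of n] word_power_neq_Nil[of w n]
  by (cases n) (auto simp: reduced_append cyclically_reduced_def)

lemma subgroup_word_power:
  assumes "subgroup H (free_group B)" "g \<star> w \<star> inv_word g \<in> H"
  shows "g \<star> word_power w n \<star> inv_word g \<in> H"
proof (induction n)
  case 0
  then show ?case
    using subgroup.one_closed[OF assms(1)] by (simp add: group_word_simps)
next
  case (Suc n)
  have "g \<star> word_power w (Suc n) \<star> inv_word g
      = (g \<star> w \<star> inv_word g) \<star> (g \<star> word_power w n \<star> inv_word g)"
    by (simp add: group_word_simps)
  then show ?case
    using subgroup_mult[OF assms Suc] by metis
qed

text \<open>Used to cut a conjugator into a part \<open>t\<close> that is absorbed by a free factor
  and a part \<open>p\<close> after which letters of the factor cannot cancel.\<close>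

lemma split_suffix:
  obtains p t where "w = p @ t" "\<forall>x\<in>set t. P x" "p = [] \<or> \<not> P (last p)"
proof -
  have "\<exists>p t. w = p @ t \<and> (\<forall>x\<in>set t. P x) \<and> (p = [] \<or> \<not> P (last p))"
  proof (induction w rule: rev_induct)
    case (snoc x w)
    then obtain p t where pt: "w = p @ t" "\<forall>x\<in>set t. P x" "p = [] \<or> \<not> P (last p)" by blast
    show ?case
    proof (cases "P x")
      case True
      then show ?thesis using pt by (intro exI[of _ p] exI[of _ "t @ [x]"]) auto
    next
      case False
      then show ?thesis by (intro exI[of _ "w @ [x]"] exI[of _ "[]"]) auto
    qed
  qed simp
  then show ?thesis using that by blast
qed

text \<open>Since \<open>\<alpha> ` H\<close> is conjugate into the free factor on \<open>C\<close>, all rays from \<open>v\<close> that are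
  asymptotic to \<open>H\<close> (translated by \<open>v g\<^sup>-\<^sup>1\<close>) are mapped by \<open>\<alpha>\<close> into the same side of the
  splitting.\<close>

lemma loops_on_one_side:
  assumes "finite B" "\<alpha> \<in> Aut_F B" "subgroup H (free_group B)"
    and "core_labels B (\<alpha> ` H) \<subseteq> C" "C \<subseteq> B1 \<or> C \<inter> B1 = {}"
    and "v \<in> words B" "g \<in> words B"
  shows "\<exists>k. \<forall>w. cyclically_reduced w \<longrightarrow> g \<star> w \<star> inv_word g \<in> H \<longrightarrow> reduced (v @ w) \<longrightarrow>
    (\<exists>N. \<forall>n\<ge>N. \<alpha> (v \<star> word_power w n) \<noteq> [] \<and>
      (fst (hd (\<alpha> (v \<star> word_power w n))) \<in> B1 \<longleftrightarrow> k))"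
proof (cases "\<exists>w. cyclically_reduced w \<and> g \<star> w \<star> inv_word g \<in> H")
  case True
  note mult = Aut_mult[OF assms(2)] and aw = Aut_words[OF assms(2)]
    and H = subgroup_words[OF assms(3)] and \<alpha>H = Aut_subgroup[OF assms(2,3)]
  from True obtain w0 where w0: "cyclically_reduced w0" "g \<star> w0 \<star> inv_word g \<in> H" by blast
  define h0 where "h0 = g \<star> w0 \<star> inv_word g"
  have "h0 \<noteq> []"
  proof
    assume "h0 = []"
    then have "inv_word g \<star> h0 \<star> g = []" by (simp add: group_word_simps)
    then show False using w0 by (simp add: h0_def group_word_simps cyclically_reduced_def)
  qed
  then have "\<alpha> h0 \<noteq> []"
    using Aut_inj[OF assms(2)] Aut_Nil[OF assms(2)] H[OF w0(2)] Nil_words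
    unfolding h0_def inj_on_def by metis
  moreover have "\<alpha> h0 \<in> words B" using aw H w0 by (simp add: h0_def)
  ultimately obtain z u where z: "z \<in> words B" "cyclically_reduced u" "\<alpha> h0 = z \<star> u \<star> inv_word z"
    using conjugate_cyclically_reduced by blast
  \<comment> \<open>One nontrivial element of \<open>H\<close> supplies a vertex \<open>z\<close> of
    the core of the image, so that conjugation by \<open>z\<close> takes the whole image into
    \<open>words C\<close>.\<close>
  have "\<alpha> h0 \<in> \<alpha> ` H" using w0 by (simp add: h0_def)
  then have "core_dir B (\<alpha> ` H) z (hd u)"
    using core_dir_loop(1)[OF \<alpha>H z(1,2)] z(3) by simp
  note factor = subgroup_conjugate_into_factor[OF \<alpha>H assms(4) this]
  define a where "a = \<alpha> (v \<star> inv_word g)"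
  obtain p t where pt: "a \<star> z = p @ t" "\<forall>x\<in>set t. fst x \<in> C" "p = [] \<or> fst (last p) \<notin> C"
    using split_suffix[of "a \<star> z" "\<lambda>x. fst x \<in> C"] by blast
  have "reduced (p @ t)" unfolding pt(1)[symmetric] by simp
  then have red: "reduced p" "t \<in> words C"
    using pt by (auto simp: reduced_append words_iff)
  define m where "m = inv_word p \<star> \<alpha> v"
  \<comment> \<open>After subtracting \<open>p\<close> and one copy of \<open>m\<close>, this bound
    leaves \<open>c\<close> longer than \<open>m\<close>, so the first letter of \<open>c\<close>
    survives in \<open>c \<star> m\<close>.\<close>
  obtain N where N: "\<And>s. s \<in> words B \<Longrightarrow> N \<le> length s \<Longrightarrow> length p + 2 * length m + 1 \<le> length (\<alpha> s)"
    using Aut_length_unbounded[OF assms(1,2)] by blast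
  \<comment> \<open>The image of the ray begins with \<open>p\<close>, or with a letter of
    \<open>C\<close> if \<open>p\<close> is empty; either way its side does not depend on the
    loop.\<close>
  define k where "k \<longleftrightarrow> (if p = [] then C \<subseteq> B1 else fst (hd p) \<in> B1)"
  show ?thesis
  proof (intro exI[of _ k] allI impI exI[of _ N])
    fix w n assume w: "cyclically_reduced w" "g \<star> w \<star> inv_word g \<in> H" "reduced (v @ w)"
      and n: "N \<le> n"
    define q where "q = word_power w n"
    define h where "h = g \<star> q \<star> inv_word g"
    have h: "h \<in> H" using subgroup_word_power[OF assms(3) w(2)] by (simp add: h_def q_def)
    define c where "c = t \<star> (inv_word z \<star> \<alpha> h \<star> z) \<star> inv_word t"
    have c: "c \<in> words C"
      using factor[of "\<alpha> h"] h red by (simp add: c_def)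
    have vg: "v \<star> inv_word g \<in> words B" using assms by simp
    have az: "a \<star> z \<star> (inv_word z \<star> inv_word a) = []" by (simp add: group_word_simps)
    have vq: "v \<star> q = (v \<star> inv_word g) \<star> (h \<star> g)"
      by (simp add: h_def group_word_simps)
    also have "\<alpha> \<dots> = a \<star> (\<alpha> h \<star> \<alpha> g)"
      using vg H[OF h] assms by (simp add: mult a_def)
    also have "\<dots> = (a \<star> z) \<star> (inv_word z \<star> \<alpha> h \<star> z) \<star> inv_word (a \<star> z) \<star> (a \<star> \<alpha> g)"
      by (simp add: group_word_simps)
    also have "\<dots> = p \<star> (c \<star> (inv_word p \<star> (a \<star> \<alpha> g)))"
      unfolding pt(1) c_def by (simp add: group_word_simps)
    also have "a \<star> \<alpha> g = \<alpha> v"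
      using assms vg reduced_words[OF assms(6)] mult[OF vg assms(7), symmetric]
      by (simp add: a_def group_word_simps)
    finally have img: "\<alpha> (v \<star> q) = p \<star> (c \<star> m)" by (simp add: m_def)
    have redq: "reduced (v @ q)"
      using reduced_append_word_power[OF w(1,3)] by (simp add: q_def)
    have "n \<le> length q"
      using w(1) length_word_power[of w n] by (simp add: q_def cyclically_reduced_def)
    then have "N \<le> length (v \<star> q)" using n redq by (simp add: mult_word_reduced)
    moreover have "v \<star> q \<in> words B"
      unfolding vq using vg H[OF h] assms by simp
    ultimately have "length p + 2 * length m + 1 \<le> length (p \<star> (c \<star> m))"
      using N img by metis
    also have "\<dots> \<le> length p + (length c + length m)"
      using length_mult_word_le[of p "c \<star> m"] length_mult_word_le[of c m] by linarith
    finally have "length m < length c" by simp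
    then have cm: "c \<star> m \<noteq> []" "hd (c \<star> m) = hd c" "c \<noteq> []"
      using hd_mult_word[of c m] reduced_words[OF c] by (auto simp: m_def)
    then have hdC: "fst (hd (c \<star> m)) \<in> C"
      using c by (auto simp: words_iff)
    then have "reduced (p @ (c \<star> m))"
      using red pt(3) by (auto simp: reduced_append)
    then have "\<alpha> (v \<star> q) = p @ (c \<star> m)"
      using img by (simp add: mult_word_reduced)
    then show "\<alpha> (v \<star> word_power w n) \<noteq> [] \<and>
        (fst (hd (\<alpha> (v \<star> word_power w n))) \<in> B1 \<longleftrightarrow> k)"
      using cm hdC assms(5) by (cases "p = []") (auto simp: k_def q_def)
  qed
qed blast

text \<open>Colour a group element by the side of the splitting to which \<open>\<alpha>\<close> maps it. Far from the
  identity the colour is locally constant. At a vertex \<open>v\<close> as far out as possible beyond which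
  both colours occur, every direction but the one leading back to the identity gets a single
  colour, so the latter is a cut vertex of the Whitehead graph.\<close>

lemma cut_vertex_exists:
  assumes "finite B" "\<alpha> \<in> Aut_F B" "B1 \<union> B2 = B" "B1 \<inter> B2 = {}" "B1 \<noteq> {}" "B2 \<noteq> {}"
    and "\<forall>H\<in>set Hs. subgroup H (free_group B) \<and>
      (core_labels B (\<alpha> ` H) \<subseteq> B1 \<or> core_labels B (\<alpha> ` H) \<subseteq> B2)"
  obtains x y0 y1 and \<chi> :: "'b letter \<Rightarrow> bool" where
    "fst x \<in> B" "fst y0 \<in> B" "fst y1 \<in> B" "y0 \<noteq> x" "y1 \<noteq> x" "\<chi> y0" "\<not> \<chi> y1"
    "\<forall>H\<in>set Hs. \<forall>g y y'. core_dir B H g y \<longrightarrow> core_dir B H g y' \<longrightarrow>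
       y \<noteq> x \<longrightarrow> y' \<noteq> x \<longrightarrow> \<chi> y = \<chi> y'"
proof -
  define c where "c s \<longleftrightarrow> \<alpha> s \<noteq> [] \<and> fst (hd (\<alpha> s)) \<in> B1" for s
  have "finite ((\<lambda>y. length (\<alpha> [y])) ` (B \<times> UNIV))" using assms(1) by simp
  \<comment> \<open>Appending a letter multiplies the image by a word shorter than \<open>M\<close>;
    once the image has length at least \<open>M\<close>, its first letter and hence the colour
    \<open>c\<close> persist.\<close>
  then obtain M where M: "\<And>y. fst y \<in> B \<Longrightarrow> length (\<alpha> [y]) < M"
    unfolding finite_nat_set_iff_bounded by (auto simp: image_iff) (metis)
  obtain N where N: "\<And>s. s \<in> words B \<Longrightarrow> N \<le> length s \<Longrightarrow> M \<le> length (\<alpha> s)"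
    using Aut_length_unbounded[OF assms(1,2)] by blast
  have step: "c (s @ [y]) = c s" if "s @ [y] \<in> words B" "N \<le> length s" for s y
  proof -
    have s: "s \<in> words B" "[y] \<in> words B" using append_words[OF that(1)] by auto
    have "s @ [y] = s \<star> [y]"
      using that(1) by (simp add: mult_word_reduced words_iff)
    then have "\<alpha> (s @ [y]) = \<alpha> s \<star> \<alpha> [y]"
      using Aut_mult[OF assms(2) s] by simp
    moreover have "length (\<alpha> [y]) < length (\<alpha> s)"
      using M[of y] N[OF s(1) that(2)] s(2) by simp
    ultimately show ?thesis
      using hd_mult_word[of "\<alpha> s" "\<alpha> [y]"] Aut_words[OF assms(2)] s reduced_words
      unfolding c_def by (metis length_0_conv not_less_zero)
  qed
  have far: "c (s @ t) = c s" if "s @ t \<in> words B" "N \<le> length s" for s t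
    using that
  proof (induction t rule: rev_induct)
    case (snoc y t)
    then have "(s @ t) @ [y] \<in> words B" by simp
    then show ?case
      using step[of "s @ t" y] snoc append_words[of "s @ t" "[y]" B] by simp
  qed simp
  \<comment> \<open>All sufficiently long words that extend \<open>v\<close> have one
    colour.\<close>
  define mono where "mono v \<longleftrightarrow> (\<exists>k. \<forall>t. v @ t \<in> words B \<longrightarrow> N \<le> length (v @ t) \<longrightarrow> c (v @ t) = k)" for v
  have mono_far: "mono v" if "N \<le> length v" for v
    using far that unfolding mono_def by blast
  \<comment> \<open>Pulling back high powers of \<open>b\<close> gives long elements whose images
    start with \<open>b\<close>; applied on both sides of the splitting, this shows that both
    colours occur.\<close>
  have long: "\<exists>g\<in>words B. N \<le> length g \<and> \<alpha> g \<noteq> [] \<and> fst (hd (\<alpha> g)) = b" if "b \<in> B" for b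
  proof -
    let ?\<beta> = "inv_into (words B) \<alpha>"
    obtain N' where N': "\<And>s. s \<in> words B \<Longrightarrow> N' \<le> length s \<Longrightarrow> N \<le> length (?\<beta> s)"
      using Aut_length_unbounded[OF assms(1) Aut_inv_into[OF assms(2)]] by blast
    define w where "w = word_power [(b, False)] (Suc N')"
    have "cyclically_reduced [(b, False)]" by (simp add: cyclically_reduced_def)
    then have w: "w \<in> words B"
      using that reduced_word_power[of "[(b, False)]" "Suc N'"] by (auto simp: w_def words_iff)
    moreover have "N' \<le> length w"
      using length_word_power[of "[(b, False)]" "Suc N'"] unfolding w_def by simp
    ultimately have "N \<le> length (?\<beta> w)" by (rule N')
    moreover have "\<alpha> (?\<beta> w) = w"
      using w Aut_bij[OF assms(2)] by (simp add: bij_betw_inv_into_right)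
    moreover have "?\<beta> w \<in> words B" using Aut_words[OF Aut_inv_into[OF assms(2)] w] .
    ultimately show ?thesis by (intro bexI[of _ "?\<beta> w"]) (auto simp: w_def)
  qed
  have "\<not> mono []"
  proof
    assume "mono []"
    then obtain k where k: "\<And>t. t \<in> words B \<Longrightarrow> N \<le> length t \<Longrightarrow> c t = k"
      unfolding mono_def by auto
    obtain b1 b2 where b: "b1 \<in> B1" "b2 \<in> B2" using assms by blast
    then have "b1 \<in> B" "b2 \<in> B" using assms(3) by auto
    from long[OF this(1)] long[OF this(2)] show False
      using k b assms(4) unfolding c_def by blast
  qed
  \<comment> \<open>A vertex with both colours beyond it has length below \<open>N\<close>, so one
    of maximal length exists.\<close>
  then have "\<exists>v. (v \<in> words B \<and> \<not> mono v) \<and> (\<forall>u. u \<in> words B \<and> \<not> mono u \<longrightarrow> length u \<le> length v)"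
    by (intro ex_has_greatest_nat[of _ "[]" _ N]) (auto intro: leI mono_far)
  then obtain v where v: "v \<in> words B" "\<not> mono v"
    and vmax: "\<And>u. u \<in> words B \<Longrightarrow> length v < length u \<Longrightarrow> mono u"
    by (meson not_le)
  have Nv: "length v < N" using v(2) mono_far not_le by blast
  define \<chi> where "\<chi> y \<longleftrightarrow> (\<exists>t. v @ y # t \<in> words B \<and> N \<le> length (v @ y # t) \<and> c (v @ y # t))" for y
  have \<chi>: "c (v @ y # t) = \<chi> y" if "v @ y # t \<in> words B" "N \<le> length (v @ y # t)" for y t
  proof -
    have "v @ [y] \<in> words B" using that append_words[of "v @ [y]" t B] by simp
    then have "mono (v @ [y])" using vmax by simp
    then obtain k where "\<And>t. v @ y # t \<in> words B \<Longrightarrow> N \<le> length (v @ y # t) \<Longrightarrow> c (v @ y # t) = k"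
      unfolding mono_def by auto
    then show ?thesis using that unfolding \<chi>_def by blast
  qed
  obtain t0 where t0: "v @ t0 \<in> words B" "N \<le> length (v @ t0)" "c (v @ t0)"
    using v(2) unfolding mono_def by metis
  obtain t1 where t1: "v @ t1 \<in> words B" "N \<le> length (v @ t1)" "\<not> c (v @ t1)"
    using v(2) unfolding mono_def by metis
  obtain y0 s0 where y0: "t0 = y0 # s0" using t0(2) Nv by (cases t0) auto
  obtain y1 s1 where y1: "t1 = y1 # s1" using t1(2) Nv by (cases t1) auto
  \<comment> \<open>For nonempty \<open>v\<close> the direction \<open>x\<close> leads back to the
    identity. At the identity there is no such direction, and any third letter serves; three exist
    since both parts of \<open>B\<close> are nonempty.\<close>
  have "\<exists>x. fst x \<in> B \<and> x \<noteq> y0 \<and> x \<noteq> y1 \<and> (v \<noteq> [] \<longrightarrow> x = inv_letter (last v))"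
  proof (cases "v = []")
    case True
    obtain b1 b2 where b: "b1 \<in> B1" "b2 \<in> B2" using assms by blast
    then have "b1 \<in> B" "b2 \<in> B" "b1 \<noteq> b2" using assms(3,4) by auto
    then have "card {(b1, False), (b1, True), (b2, False)} = 3" by auto
    moreover have "card {y0, y1} < 3" by (simp add: card_insert_if)
    ultimately have "\<not> {(b1, False), (b1, True), (b2, False)} \<subseteq> {y0, y1}"
      by (metis card_mono finite.emptyI finite_insert not_le)
    then show ?thesis using True \<open>b1 \<in> B\<close> \<open>b2 \<in> B\<close> by auto
  next
    case False
    then have "inv_letter (last v) \<noteq> y0" "inv_letter (last v) \<noteq> y1"
      using t0(1) t1(1) y0 y1 by (auto simp: words_iff reduced_append)
    moreover have "fst (last v) \<in> B" using v(1) False by (auto simp: words_iff)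
    ultimately show ?thesis by (intro exI[of _ "inv_letter (last v)"]) auto
  qed
  then obtain x where x: "fst x \<in> B" "x \<noteq> y0" "x \<noteq> y1" "v \<noteq> [] \<longrightarrow> x = inv_letter (last v)"
    by blast
  have "\<chi> y = \<chi> y'" if H: "H \<in> set Hs" and y: "core_dir B H g y" "core_dir B H g y'" "y \<noteq> x" "y' \<noteq> x"
    for H g y y'
  proof -
    have sub: "subgroup H (free_group B)" and g: "g \<in> words B"
      using assms(7) H core_dir_words[OF y(1)] by auto
    have "\<exists>C. core_labels B (\<alpha> ` H) \<subseteq> C \<and> (C \<subseteq> B1 \<or> C \<inter> B1 = {})"
      using assms(4,7) H by blast
    then obtain k where k: "\<And>w. cyclically_reduced w \<Longrightarrow> g \<star> w \<star> inv_word g \<in> H \<Longrightarrow> reduced (v @ w) \<Longrightarrow>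
      (\<exists>N. \<forall>n\<ge>N. \<alpha> (v \<star> word_power w n) \<noteq> [] \<and>
        (fst (hd (\<alpha> (v \<star> word_power w n))) \<in> B1 \<longleftrightarrow> k))"
      using loops_on_one_side[OF assms(1,2) sub _ _ v(1) g] by metis
    \<comment> \<open>Follow the powers of a loop that starts in direction \<open>y\<close>,
      transported from \<open>g\<close> to \<open>v\<close>: their eventual side is
      \<open>k\<close>, the same for every such direction at \<open>g\<close>.\<close>
    have "\<chi> y = k" if "core_dir B H g y" "y \<noteq> x" for y
    proof -
      obtain w where w: "cyclically_reduced w" "hd w = y" "g \<star> w \<star> inv_word g \<in> H"
        using \<open>core_dir B H g y\<close> unfolding core_dir_def by blast
      have "reduced (v @ w)"
        using w v(1) x(4) that(2) by (auto simp: words_iff reduced_append cyclically_reduced_def)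
      from k[OF w(1,3) this] obtain N1 where
        N1: "\<And>n. N1 \<le> n \<Longrightarrow> c (v \<star> word_power w n) = k"
        unfolding c_def by blast
      \<comment> \<open>\<open>N1\<close> ensures that the side has settled; \<open>Suc N\<close>
        makes the word long enough and keeps \<open>n\<close> positive, so that \<open>q\<close> is
        nonempty.\<close>
      define n where "n = max N1 (Suc N)"
      define q where "q = word_power w n"
      have "reduced (v @ q)"
        using reduced_append_word_power[OF w(1) \<open>reduced (v @ w)\<close>] by (simp add: q_def)
      moreover have "w \<noteq> []" using w by (simp add: cyclically_reduced_def)
      then have "q \<noteq> []" "hd q = y" "Suc N \<le> length q"
        using w(2) word_power_neq_Nil[of w n] length_word_power[of w n] by (auto simp: q_def n_def)
      then obtain s where q: "q = y # s" by (cases q) auto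
      moreover have "fst ` set q \<subseteq> B"
        using loop_words[OF sub g w(1,3)] by (force simp: q_def words_iff)
      ultimately have "v @ y # s \<in> words B" "v \<star> q = v @ y # s" "N \<le> length (v @ y # s)"
        using v(1) \<open>Suc N \<le> length q\<close> by (auto simp: words_iff mult_word_reduced)
      then show ?thesis
        using \<chi>[of y s] N1[of n] by (simp add: q_def n_def)
    qed
    then show ?thesis using y by blast
  qed
  moreover have "\<chi> y0" "\<not> \<chi> y1" "fst y0 \<in> B" "fst y1 \<in> B"
    using t0 t1 \<chi>[of y0 s0] \<chi>[of y1 s1] unfolding y0 y1 by (auto simp: words_iff)
  ultimately show ?thesis
    using that[of x y0 y1 \<chi>] x by blast
qed

section \<open>Whitehead automorphisms\<close>

text \<open>For \<open>A\<close> containing neither \<open>x\<close> nor its inverse this is the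
  Whitehead automorphism with multiplier \<open>x\<close>. The two tests make the images of inverse
  letters inverse to each other.\<close>

definition whitehead_letter :: "'b letter \<Rightarrow> 'b letter set \<Rightarrow> 'b letter \<Rightarrow> 'b word" where
  "whitehead_letter x A y =
     (if y \<in> A then [x] else []) @ [y] @ (if inv_letter y \<in> A then [inv_letter x] else [])"

definition whitehead :: "'b letter \<Rightarrow> 'b letter set \<Rightarrow> 'b word \<Rightarrow> 'b word" where
  "whitehead x A w = red (concat (map (whitehead_letter x A) w))"

lemma whitehead_letter_inv:
  "whitehead_letter x A (inv_letter y) = inv_word (whitehead_letter x A y)"
  by (simp add: whitehead_letter_def inv_word_Cons)

lemma reduced_whitehead [simp]: "reduced (whitehead x A w)"
  by (simp add: whitehead_def)

lemma whitehead_append: "whitehead x A (u @ v) = whitehead x A u \<star> whitehead x A v"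
  by (simp add: whitehead_def mult_word_def)

lemma whitehead_Nil [simp]: "whitehead x A [] = []"
  by (simp add: whitehead_def)

lemma whitehead_Cons: "whitehead x A (y # v) = whitehead_letter x A y \<star> whitehead x A v"
  by (simp add: whitehead_def mult_word_def)

lemma whitehead_cancel: "whitehead x A (cancel y u) = whitehead_letter x A y \<star> whitehead x A u"
proof (cases u)
  case (Cons z v)
  then show ?thesis
    by (auto simp: whitehead_Cons whitehead_letter_inv inv_word_mult_cancel red_reduced)
qed (simp add: whitehead_Cons)

lemma whitehead_red: "whitehead x A (red w) = whitehead x A w"
  by (induction w) (auto simp: red_Cons whitehead_cancel whitehead_Cons)

lemma whitehead_mult: "whitehead x A (u \<star> v) = whitehead x A u \<star> whitehead x A v"
  unfolding mult_word_def[of u v] whitehead_red by (rule whitehead_append)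

lemma whitehead_words:
  assumes "fst x \<in> B" "w \<in> words B"
  shows "whitehead x A w \<in> words B"
  unfolding whitehead_def
proof (rule red_words)
  have "fst z \<in> {fst x, fst y}" if "z \<in> set (whitehead_letter x A y)" for y z
    using that by (cases "y \<in> A"; cases "inv_letter y \<in> A") (auto simp: whitehead_letter_def)
  then show "fst ` set (concat (map (whitehead_letter x A) w)) \<subseteq> B"
    using assms by (fastforce simp: words_iff)
qed

lemma whitehead_singleton:
  "whitehead x A [y] = (if y \<in> A then [x] else []) \<star> [y] \<star>
     inv_word (if inv_letter y \<in> A then [x] else [])"
  by (simp add: whitehead_def whitehead_letter_def mult_word_def)

lemma whitehead_fixed:
  assumes "x \<notin> A" "inv_letter x \<notin> A"
  shows "whitehead z A [x] = [x]" "whitehead z A [inv_letter x] = [inv_letter x]"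
  using assms by (auto simp: whitehead_singleton group_word_simps)

text \<open>Both maps fix \<open>x\<close>, so the factors inserted by one are undone by the
  other.\<close>

lemma whitehead_inverse:
  assumes "x \<notin> A" "inv_letter x \<notin> A"
  shows "whitehead (inv_letter x) A (whitehead x A w) = red w"
proof (induction w)
  case (Cons y w)
  note fixed = whitehead_fixed[OF assms]
  have y: "whitehead_letter x A y = (if y \<in> A then [x] else []) @ [y] @
      (if inv_letter y \<in> A then [inv_letter x] else [])"
    by (simp add: whitehead_letter_def)
  have "whitehead (inv_letter x) A (whitehead_letter x A y) = [y]"
    unfolding y whitehead_append
    using assms by (simp add: fixed whitehead_singleton group_word_simps)
  then show ?case
    using Cons by (simp add: whitehead_Cons whitehead_mult group_word_simps)
      (simp add: mult_word_def)
qed simp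

lemma whitehead_inverse':
  assumes "x \<notin> A" "inv_letter x \<notin> A"
  shows "whitehead x A (whitehead (inv_letter x) A w) = red w"
  using whitehead_inverse[of "inv_letter x" A w] assms by simp

lemma whitehead_Aut:
  assumes "fst x \<in> B" "x \<notin> A" "inv_letter x \<notin> A"
  shows "whitehead x A \<in> Aut_F B"
  unfolding Aut_F_def
proof (rule isoI)
  show "whitehead x A \<in> hom (free_group B) (free_group B)"
    using assms(1) by (auto simp: hom_def whitehead_words whitehead_mult)
  show "bij_betw (whitehead x A) (words B) (words B)"
  proof (rule bij_betw_byWitness[where f' = "whitehead (inv_letter x) A"])
    show "whitehead x A ` words B \<subseteq> words B"
      using whitehead_words[OF assms(1)] by blast
    show "whitehead (inv_letter x) A ` words B \<subseteq> words B"
      using whitehead_words[of "inv_letter x" B] assms(1) by auto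
  qed (use assms in \<open>auto simp: whitehead_inverse whitehead_inverse' reduced_words red_reduced\<close>)
qed

text \<open>The core of the image of \<open>H\<close> arises from the core of \<open>H\<close> by collapsing the
  \<open>x\<close>-edges that start at a vertex with a core direction in \<open>A\<close>. The predicate \<open>E\<close> describes the
  remaining edges and \<open>\<tau>\<close> is the collapsing map on vertices.\<close>

lemma core_edges_whitehead:
  fixes x :: "'b letter" and A :: "'b letter set" and B :: "'b set" and H :: "'b word set"
  defines "meets \<equiv> \<lambda>g. \<exists>a\<in>A. core_dir B H g a"
  assumes H: "subgroup H (free_group B)" and x: "fst x \<in> B" "x \<notin> A" "inv_letter x \<notin> A"
    and cut: "\<And>g. (\<forall>y. core_dir B H g y \<longrightarrow> y = x \<or> y \<in> A) \<or> (\<forall>y\<in>A. \<not> core_dir B H g y)"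
  obtains \<kappa> where "core_edges B (whitehead x A ` H) \<subseteq>
    \<kappa> ` {(r_coset (free_group B) H v, b) |v b. core_dir B H v (b, False) \<and>
      ((b, False) = x \<longrightarrow> \<not> meets v) \<and> ((b, False) = inv_letter x \<longrightarrow> \<not> meets (v \<star> [inv_letter x]))}"
proof -
  let ?D = "core_dir B H"
  define \<phi> where "\<phi> = whitehead x A"
  define \<psi> where "\<psi> = whitehead (inv_letter x) A"
  define e where "e y = (if y \<in> A then [x] else [])" for y
  have \<phi>Aut: "\<phi> \<in> Aut_F B" unfolding \<phi>_def by (rule whitehead_Aut[OF x])
  have \<phi>H: "subgroup (\<phi> ` H) (free_group B)" by (rule Aut_subgroup[OF \<phi>Aut H])
  have \<phi>\<psi> [simp]: "\<phi> (\<psi> w) = red w" "\<psi> (\<phi> w) = red w" for w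
    using x by (simp_all add: \<phi>_def \<psi>_def whitehead_inverse whitehead_inverse')
  have mult [simp]: "\<phi> (u \<star> v) = \<phi> u \<star> \<phi> v" "\<psi> (u \<star> v) = \<psi> u \<star> \<psi> v" for u v
    by (simp_all add: \<phi>_def \<psi>_def whitehead_mult)
  have fixed [simp]: "\<phi> [x] = [x]" "\<phi> [inv_letter x] = [inv_letter x]"
      "\<psi> [x] = [x]" "\<psi> [inv_letter x] = [inv_letter x]" "\<phi> [] = []" "\<psi> [] = []"
    using x by (simp_all add: \<phi>_def \<psi>_def whitehead_fixed)
  have \<phi>_letter: "\<phi> [y] = e y \<star> [y] \<star> inv_word (e (inv_letter y))" for y
    by (simp add: \<phi>_def e_def whitehead_singleton)
  have \<psi>_letter: "\<psi> [y] = inv_word (e y) \<star> [y] \<star> e (inv_letter y)" for y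
    by (simp add: \<psi>_def e_def whitehead_singleton)
  have \<phi>e [simp]: "\<phi> (e y) = e y" "\<psi> (e y) = e y" for y
    by (simp_all add: e_def)
  have red\<phi>\<psi> [simp]: "reduced (\<phi> w)" "reduced (\<psi> w)" "reduced (e y)" for w y
    by (simp_all add: \<phi>_def \<psi>_def e_def)
  have ex [simp]: "e x = []" "e (inv_letter x) = []" using x by (simp_all add: e_def)
  note D_sym = edges_symD[OF edges_sym_core_dir[OF H]]
    and D_inv = edges_invariantD[OF edges_invariant_core_dir[OF H]]
  have meets_inv: "meets (h \<star> g) = meets g" if "h \<in> H" "reduced g" for h g
    using D_inv[OF that] unfolding meets_def by blast
  have not_meets: "\<not> meets g" if "?D g (inv_letter x)" for g
    using cut[of g] that x(3) unfolding meets_def by (metis inv_letter_neq(1))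
  have meets_iff: "meets g \<longleftrightarrow> y \<in> A" if "?D g y" "y \<noteq> x" for g y
    using cut[of g] that unfolding meets_def by blast

  \<comment> \<open>By the formula for \<open>\<phi> [y]\<close>, the edge \<open>y\<close> leaving
    \<open>v\<close> becomes the edge \<open>y\<close> leaving \<open>\<phi> v \<star> e y\<close>;
    \<open>E\<close> solves this for \<open>v\<close>. The last two conditions omit the collapsed
    \<open>x\<close>-edges in both orientations.\<close>
  define E where "E g y \<longleftrightarrow> ?D (\<psi> g \<star> inv_word (e y)) y \<and> (y = x \<longrightarrow> \<not> meets (\<psi> g)) \<and>
      (y = inv_letter x \<longrightarrow> \<not> meets (\<psi> g \<star> [inv_letter x]))" for g y
  have E_sym: "edges_sym E"
    unfolding edges_sym_def
  proof (intro allI impI)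
    fix g y assume E: "E g y"
    have "\<psi> (g \<star> [y]) \<star> inv_word (e (inv_letter y)) = \<psi> g \<star> inv_word (e y) \<star> [y]"
      by (simp add: \<psi>_letter group_word_simps)
    moreover have "\<psi> (g \<star> [x]) \<star> [inv_letter x] = \<psi> g"
      by (simp add: group_word_simps)
    moreover have "inv_letter y = x \<longleftrightarrow> y = inv_letter x" by auto
    ultimately show "E (g \<star> [y]) (inv_letter y)"
      using E D_sym[of "\<psi> g \<star> inv_word (e y)" y] unfolding E_def by auto
  qed
  have E_inv: "edges_invariant E (\<phi> h)" if "h \<in> H" for h
    unfolding edges_invariant_def
  proof (intro allI impI)
    fix p :: "'b word" and y assume "reduced p"
    have "reduced h" using H that subgroup_words reduced_words by blast
    then have "\<psi> (\<phi> h \<star> p) = h \<star> \<psi> p" by (simp add: group_word_simps)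
    then show "E (\<phi> h \<star> p) y = E p y"
      using that by (simp add: E_def mult_word_assoc D_inv meets_inv)
  qed

  \<comment> \<open>The shift by \<open>x\<close> at vertices meeting \<open>A\<close> makes the
    images of edges start at the images of their vertices, and gives both ends of a collapsed
    \<open>x\<close>-edge the same image.\<close>
  define \<tau> where "\<tau> v = \<phi> v \<star> (if meets v then [x] else [])" for v
  have red\<tau> [simp]: "reduced (\<tau> v)" for v by (simp add: \<tau>_def)
  have step: "\<exists>u. path_in E (\<tau> v) u \<and> \<tau> v \<star> u = \<tau> (v \<star> [y])" if "?D v y" for v y
  proof -
    have v: "reduced v" using that core_dir_words reduced_words by blast
    have D': "?D (v \<star> [y]) (inv_letter y)" using D_sym[OF v that] .
    have edge: ?thesis if "\<tau> v = \<phi> v \<star> e y" "\<tau> (v \<star> [y]) = \<phi> v \<star> e y \<star> [y]" "y = x \<Longrightarrow> \<not> meets v"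
      "y = inv_letter x \<Longrightarrow> \<not> meets (v \<star> [inv_letter x])"
      using that \<open>?D v y\<close> v
      by (intro exI[of _ "[y]"]) (auto simp: E_def group_word_simps)
    consider "y \<noteq> x" "y \<noteq> inv_letter x" | "y = x" | "y = inv_letter x" by blast
    then show ?thesis
    proof cases
      case 1
      \<comment> \<open>By the cut hypothesis, a single core direction other than \<open>x\<close>
        decides whether a vertex meets \<open>A\<close>, so the shifts at both ends match
        \<open>e\<close>.\<close>
      then have "inv_letter y \<noteq> x" by auto
      then have "meets v \<longleftrightarrow> y \<in> A" "meets (v \<star> [y]) \<longleftrightarrow> inv_letter y \<in> A"
        using meets_iff[OF \<open>?D v y\<close>] meets_iff[OF D'] 1 by auto
      then have "\<tau> v = \<phi> v \<star> e y" "\<tau> (v \<star> [y]) = \<phi> (v \<star> [y]) \<star> e (inv_letter y)"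
        by (simp_all add: \<tau>_def e_def)
      moreover have "\<phi> (v \<star> [y]) \<star> e (inv_letter y) = \<phi> v \<star> e y \<star> [y]"
        by (simp add: \<phi>_letter group_word_simps)
      ultimately show ?thesis using edge 1 by simp
    next
      case 2
      then have nm: "\<not> meets (v \<star> [x])" using not_meets D' by simp
      show ?thesis
      proof (cases "meets v")
        case True
        then have "\<tau> v = \<tau> (v \<star> [x])"
          using nm by (simp add: \<tau>_def group_word_simps)
        then show ?thesis using 2 by (intro exI[of _ "[]"]) (simp add: group_word_simps)
      next
        case False
        then show ?thesis using edge nm 2 by (simp add: \<tau>_def group_word_simps)
      qed
    next
      case 3
      then have nm: "\<not> meets v" using not_meets \<open>?D v y\<close> by simp
      show ?thesis
      proof (cases "meets (v \<star> [inv_letter x])")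
        case True
        then have "\<tau> v = \<tau> (v \<star> [inv_letter x])"
          using nm by (simp add: \<tau>_def group_word_simps)
        then show ?thesis using 3 by (intro exI[of _ "[]"]) (simp add: group_word_simps)
      next
        case False
        then show ?thesis using edge nm 3 by (simp add: \<tau>_def group_word_simps)
      qed
    qed
  qed
  have path: "\<exists>u. path_in E (\<tau> v) u \<and> \<tau> v \<star> u = \<tau> (v \<star> w)" if "path_in ?D v w" "reduced v" for v w
    using that
  proof (induction w arbitrary: v)
    case Nil
    then show ?case by (intro exI[of _ "[]"]) (simp add: group_word_simps)
  next
    case (Cons y w)
    then obtain u where u: "path_in E (\<tau> v) u" "\<tau> v \<star> u = \<tau> (v \<star> [y])"
      using step[of v y] by auto
    obtain u' where u': "path_in E (\<tau> (v \<star> [y])) u'" "\<tau> (v \<star> [y]) \<star> u' = \<tau> (v \<star> [y] \<star> w)"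
      using Cons.IH[of "v \<star> [y]"] Cons.prems by auto
    show ?case
      using u u' by (intro exI[of _ "u @ u'"])
        (simp add: path_in_append mult_append mult_Cons_assoc flip: mult_word_assoc)
  qed
  \<comment> \<open>A core loop for \<open>\<phi> h\<close> is a cyclically reduced conjugate of the
    image under \<open>\<tau>\<close> of a core loop for \<open>h\<close>, and that image lies in
    \<open>E\<close>.\<close>
  have core: "E g y" if "core_dir B (\<phi> ` H) g y" for g y
  proof -
    obtain w where w: "cyclically_reduced w" "hd w = y" "g \<star> w \<star> inv_word g \<in> \<phi> ` H"
      and g: "reduced g"
      using \<open>core_dir B (\<phi> ` H) g y\<close> reduced_words unfolding core_dir_def by blast
    then obtain h where h: "h \<in> H" "g \<star> w \<star> inv_word g = \<phi> h" by blast
    have "h \<noteq> []"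
    proof
      assume "h = []"
      then have "inv_word g \<star> (g \<star> w \<star> inv_word g) \<star> g = []"
        using h by (simp add: group_word_simps)
      then show False using w by (simp add: group_word_simps cyclically_reduced_def)
    qed
    then obtain z s where z: "z \<in> words B" "cyclically_reduced s" "h = z \<star> s \<star> inv_word z"
      using conjugate_cyclically_reduced subgroup_words[OF H h(1)] by blast
    have zr: "reduced z" using z reduced_words by blast
    have "path_in ?D z s" using path_in_core[OF H z(1,2)] z(3) h(1) by simp
    then obtain u where u: "path_in E (\<tau> z) u" "\<tau> z \<star> u = \<tau> (z \<star> s)"
      using path zr by blast
    have "z \<star> s = h \<star> z" by (simp add: z(3) group_word_simps)
    then have "\<tau> (z \<star> s) = \<phi> h \<star> \<tau> z"
      using meets_inv[OF h(1) zr] by (simp add: \<tau>_def group_word_simps)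
    then have conj: "\<tau> z \<star> red u \<star> inv_word (\<tau> z) = \<phi> h"
      using u(2) by (simp add: mult_word_red(1)) (simp add: group_word_simps)
    have "path_in E (\<tau> z \<star> inv_word (inv_word g \<star> \<tau> z)) w"
    proof (rule path_in_cyclically_reduced_conjugate[OF E_sym])
      show "edges_invariant E (\<tau> z \<star> red u \<star> inv_word (\<tau> z))"
        using conj E_inv h by simp
      show "path_in E (\<tau> z) (red u)" using u by (simp add: path_in_red)
      have "(inv_word g \<star> \<tau> z) \<star> red u \<star> inv_word (inv_word g \<star> \<tau> z)
          = inv_word g \<star> (\<tau> z \<star> red u \<star> inv_word (\<tau> z)) \<star> g"
        by (simp add: group_word_simps)
      also have "\<dots> = w"
        unfolding conj h(2)[symmetric] using w by (simp add: group_word_simps cyclically_reduced_def)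
      finally show "(inv_word g \<star> \<tau> z) \<star> red u \<star> inv_word (inv_word g \<star> \<tau> z) = w" .
    qed (use w in auto)
    moreover have "\<tau> z \<star> inv_word (inv_word g \<star> \<tau> z) = g"
      using g by (simp add: group_word_simps)
    ultimately show ?thesis
      using w by (cases w) (auto simp: cyclically_reduced_def)
  qed

  \<comment> \<open>Taking the image of the whole coset as a set avoids a choice of
    representatives.\<close>
  define \<kappa> where "\<kappa> c = ((\<lambda>q. \<phi> q \<star> e (snd c, False)) ` fst c, snd c)" for c :: "'b word set \<times> 'b"
  have "core_edges B (\<phi> ` H) \<subseteq>
    \<kappa> ` {(r_coset (free_group B) H v, b) |v b. ?D v (b, False) \<and>
      ((b, False) = x \<longrightarrow> \<not> meets v) \<and> ((b, False) = inv_letter x \<longrightarrow> \<not> meets (v \<star> [inv_letter x]))}"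
    (is "_ \<subseteq> \<kappa> ` ?K")
  proof
    fix c assume "c \<in> core_edges B (\<phi> ` H)"
    then obtain g b where c: "c = (r_coset (free_group B) (\<phi> ` H) g, b)"
      and d: "core_dir B (\<phi> ` H) g (b, False)"
      unfolding core_edges_eq[OF \<phi>H] by blast
    have g: "reduced g" using d core_dir_words reduced_words by blast
    define v where "v = \<psi> g \<star> inv_word (e (b, False))"
    have E: "E g (b, False)" using core[OF d] .
    moreover have "v = \<psi> g" if "(b, False) = x \<or> (b, False) = inv_letter x"
    proof -
      have "e (b, False) = []" using that ex by metis
      then show ?thesis by (simp add: v_def group_word_simps)
    qed
    ultimately have "?D v (b, False) \<and> ((b, False) = x \<longrightarrow> \<not> meets v) \<and>
        ((b, False) = inv_letter x \<longrightarrow> \<not> meets (v \<star> [inv_letter x]))"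
      unfolding E_def v_def[symmetric] by metis
    then have "(r_coset (free_group B) H v, b) \<in> ?K" by blast
    moreover have "\<kappa> (r_coset (free_group B) H v, b) = c"
    proof -
      have v: "\<phi> (h \<star> v) \<star> e (b, False) = \<phi> h \<star> g" for h
      proof -
        have "\<phi> (inv_word (e (b, False))) = inv_word (e (b, False))"
          by (simp add: e_def)
        then show ?thesis using g by (simp add: v_def group_word_simps)
      qed
      have "r_coset (free_group B) H v = (\<lambda>h. h \<star> v) ` H"
        "r_coset (free_group B) (\<phi> ` H) g = (\<lambda>h. \<phi> h \<star> g) ` H"
        by (auto simp: r_coset_def)
      then show ?thesis
        by (simp only: \<kappa>_def c fst_conv snd_conv image_image v)
    qed
    ultimately show "c \<in> \<kappa> ` ?K" by blast
  qed
  then show ?thesis using that unfolding \<phi>_def by blast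
qed

text \<open>The new core has at most as many edges as \<open>K\<close>, the set of core edges that
  are not collapsed. An \<open>x\<close>-edge at a vertex that also has a core direction in
  \<open>A\<close> lies outside \<open>K\<close>, which gives strictness.\<close>

lemma card_core_edges_whitehead:
  assumes "fin_gen_subgroup B H" and x: "fst x \<in> B" "x \<notin> A" "inv_letter x \<notin> A"
    and cut: "\<And>g. (\<forall>y. core_dir B H g y \<longrightarrow> y = x \<or> y \<in> A) \<or> (\<forall>y\<in>A. \<not> core_dir B H g y)"
  shows "card (core_edges B (whitehead x A ` H)) \<le> card (core_edges B H)"
    and "core_dir B H g x \<Longrightarrow> a \<in> A \<Longrightarrow> core_dir B H g a \<Longrightarrow>
      card (core_edges B (whitehead x A ` H)) < card (core_edges B H)"
proof -
  have H: "subgroup H (free_group B)" and fin: "finite (core_edges B H)"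
    using assms(1) finite_core_edges by (auto simp: fin_gen_subgroup_def)
  define meets where "meets g \<longleftrightarrow> (\<exists>a\<in>A. core_dir B H g a)" for g
  define K where "K = {(r_coset (free_group B) H v, b) |v b. core_dir B H v (b, False) \<and>
      ((b, False) = x \<longrightarrow> \<not> meets v) \<and> ((b, False) = inv_letter x \<longrightarrow> \<not> meets (v \<star> [inv_letter x]))}"
  obtain \<kappa> where \<kappa>: "core_edges B (whitehead x A ` H) \<subseteq> \<kappa> ` K"
    using core_edges_whitehead[OF H x cut] unfolding K_def meets_def by blast
  have K: "K \<subseteq> core_edges B H"
    unfolding K_def core_edges_eq[OF H] by blast
  then have "finite K" using fin finite_subset by blast
  then have le: "card (core_edges B (whitehead x A ` H)) \<le> card K"
    using \<kappa> by (meson card_image_le card_mono finite_imageI le_trans)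
  then show "card (core_edges B (whitehead x A ` H)) \<le> card (core_edges B H)"
    using card_mono[OF fin K] by linarith
  assume g: "core_dir B H g x" "a \<in> A" "core_dir B H g a"
  have gr: "g \<in> words B" "reduced g" using g core_dir_words reduced_words by blast+
  interpret group "free_group B" by (rule group_free_group)
  have coset: "\<exists>h\<in>H. v = h \<star> u" if "r_coset (free_group B) H v = r_coset (free_group B) H u"
      "v \<in> words B" for u v
    using that rcos_self[OF that(2) H] unfolding r_coset_def by auto
  have meets: "meets (h \<star> g)" if "h \<in> H" for h
    using edges_invariantD[OF edges_invariant_core_dir[OF H that] gr(2)] g unfolding meets_def by blast
  \<comment> \<open>Edges are recorded with a positive letter; if \<open>x\<close> is an inverse
    letter, the collapsed edge is recorded at its other end.\<close>
  define v where "v = (if snd x then g \<star> [x] else g)"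
  define c where "c = (r_coset (free_group B) H v, fst x)"
  have "core_dir B H v (fst x, False)"
  proof (cases "snd x")
    case True
    then have "(fst x, False) = inv_letter x" by (simp add: inv_letter_def)
    then show ?thesis
      using True edges_symD[OF edges_sym_core_dir[OF H] gr(2) g(1)] by (simp add: v_def)
  next
    case False
    then show ?thesis using g(1) by (simp add: v_def) (metis prod.collapse)
  qed
  then have "c \<in> core_edges B H"
    unfolding c_def core_edges_eq[OF H] by blast
  moreover have "c \<notin> K"
  proof
    assume "c \<in> K"
    then obtain u where u: "r_coset (free_group B) H u = r_coset (free_group B) H v"
      "core_dir B H u (fst x, False)" "(fst x, False) = x \<longrightarrow> \<not> meets u"
      "(fst x, False) = inv_letter x \<longrightarrow> \<not> meets (u \<star> [inv_letter x])"
      unfolding K_def c_def by auto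
    \<comment> \<open>Membership in \<open>K\<close> may come from another representative of the
      coset, but it differs by an element of \<open>H\<close>, which preserves
      \<open>meets\<close>.\<close>
    obtain h where h: "h \<in> H" "u = h \<star> v"
      using coset[OF u(1) core_dir_words[OF u(2)]] by blast
    show False
    proof (cases "snd x")
      case True
      then have "(fst x, False) = inv_letter x" by (simp add: inv_letter_def)
      moreover have "u \<star> [inv_letter x] = h \<star> g"
        using True gr(2) h by (simp add: v_def group_word_simps)
      ultimately show False using u(4) meets[OF h(1)] by simp
    next
      case False
      then have "(fst x, False) = x" "u = h \<star> g" using h by (auto simp: v_def prod_eq_iff)
      then show False using u(3) meets[OF h(1)] by simp
    qed
  qed
  ultimately have "card K < card (core_edges B H)"
    using K fin by (metis psubsetI psubset_card_mono)
  then show "card (core_edges B (whitehead x A ` H)) < card (core_edges B H)"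
    using le by linarith
qed

lemma sum_list_less:
  fixes f g :: "'a \<Rightarrow> nat"
  assumes "\<And>x. x \<in> set xs \<Longrightarrow> f x \<le> g x" "y \<in> set xs" "f y < g y"
  shows "(\<Sum>x\<leftarrow>xs. f x) < (\<Sum>x\<leftarrow>xs. g x)"
  using assms
proof (induction xs)
  case (Cons z xs)
  have le: "f z \<le> g z" "(\<Sum>x\<leftarrow>xs. f x) \<le> (\<Sum>x\<leftarrow>xs. g x)"
    using Cons.prems(1) by (auto intro: sum_list_mono)
  show ?case
  proof (cases "y = z")
    case True
    then show ?thesis using le Cons.prems by auto
  next
    case False
    then show ?thesis using le Cons by force
  qed
qed simp

lemma whitehead_reduces_complexity:
  assumes "\<forall>H\<in>set Hs. fin_gen_subgroup B H" "fst x \<in> B" "x \<notin> A" "inv_letter x \<notin> A"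
    and "\<And>H g. H \<in> set Hs \<Longrightarrow>
      (\<forall>y. core_dir B H g y \<longrightarrow> y = x \<or> y \<in> A) \<or> (\<forall>y\<in>A. \<not> core_dir B H g y)"
    and "H \<in> set Hs" "core_dir B H g x" "a \<in> A" "core_dir B H g a"
  shows "\<exists>\<phi>\<in>Aut_F B. complexity B (act \<phi> Hs) < complexity B Hs"
proof
  show "whitehead x A \<in> Aut_F B" using whitehead_Aut[OF assms(2-4)] .
  have "(\<Sum>H\<leftarrow>Hs. card (core_edges B (whitehead x A ` H))) < (\<Sum>H\<leftarrow>Hs. card (core_edges B H))"
  proof (rule sum_list_less[OF _ assms(6)])
    show "card (core_edges B (whitehead x A ` H)) \<le> card (core_edges B H)" if "H \<in> set Hs" for H
      using card_core_edges_whitehead(1)[OF _ assms(2-4,5)] assms(1) that by blast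
    show "card (core_edges B (whitehead x A ` H)) < card (core_edges B H)"
      using card_core_edges_whitehead(2)[OF _ assms(2-4,5) assms(7-9)] assms(1,6) by blast
  qed
  then show "complexity B (act (whitehead x A) Hs) < complexity B Hs"
    by (simp add: complexity_def act_def comp_def)
qed

section \<open>Visible blow-ups\<close>

lemma core_labels_subset: "subgroup H (free_group B) \<Longrightarrow> core_labels B H \<subseteq> B"
  using core_dir_label by (fastforce simp: core_labels_iff)

text \<open>Core edges can be reversed, so if one sign of \<open>b\<close> never occurs, neither
  does the other, and \<open>{b}\<close> splits off.\<close>

lemma visibly_blown_up_if_unused_label:
  assumes "\<forall>H\<in>set Hs. subgroup H (free_group B)" "b \<in> B" "b' \<in> B" "b \<noteq> b'"
    and "\<And>H g. H \<in> set Hs \<Longrightarrow> \<not> core_dir B H g (b, s)"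
  shows "visibly_blown_up B Hs"
proof -
  have "core_labels B H \<subseteq> B - {b}" if "H \<in> set Hs" for H
  proof -
    have H: "subgroup H (free_group B)" using that assms(1) by blast
    have "fst y \<noteq> b" if d: "core_dir B H g y" for g y
    proof
      assume "fst y = b"
      then have "y = (b, s) \<or> inv_letter y = (b, s)"
        by (auto simp: inv_letter_def prod_eq_iff)
      then show False
        using assms(5)[OF \<open>H \<in> set Hs\<close>] d edges_symD[OF edges_sym_core_dir[OF H] _ d]
          core_dir_words[OF d] reduced_words by metis
    qed
    then show ?thesis
      using core_labels_subset[OF H] unfolding core_labels_iff[OF H] by blast
  qed
  then show ?thesis
    unfolding visibly_blown_up_def using assms(2-4)
    by (intro exI[of _ "{b}"] exI[of _ "B - {b}"]) auto
qed

lemma visibly_blown_up_if_saturated: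
  assumes "\<forall>H\<in>set Hs. subgroup H (free_group B)" "a \<in> A" "fst x \<in> B" "x \<notin> A"
    and A: "fst ` A \<subseteq> B" "\<And>y. y \<in> A \<Longrightarrow> inv_letter y \<in> A"
    and sat: "\<And>H g y y'. H \<in> set Hs \<Longrightarrow> core_dir B H g y \<Longrightarrow> core_dir B H g y' \<Longrightarrow> y \<in> A \<Longrightarrow> y' \<in> A"
  shows "visibly_blown_up B Hs"
proof -
  have fstA: "y \<in> A" if "fst y \<in> fst ` A" for y
  proof -
    obtain z where "z \<in> A" "fst y = fst z" using \<open>fst y \<in> fst ` A\<close> by auto
    then show ?thesis using A(2) unfolding fst_eq_iff_letter by blast
  qed
  have "core_labels B H \<subseteq> fst ` A \<or> core_labels B H \<subseteq> B - fst ` A" if HHs: "H \<in> set Hs" for H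
  proof (cases "\<exists>g y. core_dir B H g y \<and> y \<in> A")
    case True
    have H: "subgroup H (free_group B)" using that assms(1) by blast
    from True obtain g y where g: "core_dir B H g y" "y \<in> A" by blast
    have along: "\<exists>y\<in>A. core_dir B H (p \<star> w) y"
      if "path_in (core_dir B H) p w" "\<exists>y\<in>A. core_dir B H p y" for p w
      using that
    proof (induction w arbitrary: p)
      case Nil
      then obtain y where y: "y \<in> A" "core_dir B H p y" by auto
      then have "p \<star> [] = p"
        using reduced_words[OF core_dir_words[OF y(2)]] by (simp add: group_word_simps)
      then show ?case using y by auto
    next
      case (Cons z w)
      then have z: "core_dir B H p z" by simp
      then have zA: "z \<in> A" using sat[OF HHs _ z] Cons.prems(2) by blast
      from z have "core_dir B H (p \<star> [z]) (inv_letter z)"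
        using edges_symD[OF edges_sym_core_dir[OF H] _ z] core_dir_words reduced_words by blast
      moreover have "path_in (core_dir B H) (p \<star> [z]) w" using Cons.prems(1) by simp
      ultimately have "\<exists>y\<in>A. core_dir B H (p \<star> [z] \<star> w) y"
        using Cons.IH A(2)[OF zA] by blast
      then show ?case unfolding mult_Cons_assoc .
    qed
    have "fst y' \<in> fst ` A" if d: "core_dir B H g' y'" for g' y'
    proof -
      have "g \<star> (inv_word g \<star> g') = g'"
        using reduced_words[OF core_dir_words[OF d]] by (simp add: group_word_simps)
      then have "path_in (core_dir B H) g (inv_word g \<star> g')"
        using core_connected[OF H reduced_mult_word g(1), of "inv_word g" g' y'] d by simp
      then have "\<exists>y\<in>A. core_dir B H (g \<star> (inv_word g \<star> g')) y"
        using along g by blast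
      then have "\<exists>y\<in>A. core_dir B H g' y"
        unfolding \<open>g \<star> (inv_word g \<star> g') = g'\<close> .
      then have "y' \<in> A" using sat[OF HHs] d by blast
      then show ?thesis by (rule imageI)
    qed
    then have "core_labels B H \<subseteq> fst ` A" unfolding core_labels_iff[OF H] by auto
    then show ?thesis ..
  next
    case False
    have H: "subgroup H (free_group B)" using that assms(1) by blast
    have "fst y \<in> B - fst ` A" if "core_dir B H g y" for g y
      using False fstA[of y] core_dir_label[OF \<open>core_dir B H g y\<close> H] \<open>core_dir B H g y\<close> by blast
    then have "core_labels B H \<subseteq> B - fst ` A"
      unfolding core_labels_iff[OF H] by (intro subsetI) (elim CollectE exE conjE, simp only:)
    then show ?thesis ..
  qed
  moreover have "fst x \<in> B - fst ` A" using fstA[of x] assms(3,4) by blast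
  then have "B - fst ` A \<noteq> {}" by force
  moreover have "fst ` A \<union> (B - fst ` A) = B" "fst ` A \<inter> (B - fst ` A) = {}" "fst ` A \<noteq> {}"
    using assms(2) A(1) by auto
  ultimately show ?thesis
    unfolding visibly_blown_up_def by (intro exI[of _ "fst ` A"] exI[of _ "B - fst ` A"]) simp
qed

lemma visibly_blown_up_or_reducible:
  assumes "finite B" "\<forall>H\<in>set Hs. fin_gen_subgroup B H" "\<alpha> \<in> Aut_F B"
    and "visibly_blown_up B (act \<alpha> Hs)"
  shows "visibly_blown_up B Hs \<or> (\<exists>\<phi>\<in>Aut_F B. complexity B (act \<phi> Hs) < complexity B Hs)"
proof -
  have sub: "\<forall>H\<in>set Hs. subgroup H (free_group B)"
    using assms(2) by (auto simp: fin_gen_subgroup_def)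
  obtain B1 B2 where B: "B1 \<union> B2 = B" "B1 \<inter> B2 = {}" "B1 \<noteq> {}" "B2 \<noteq> {}"
    and "\<forall>H\<in>set Hs. core_labels B (\<alpha> ` H) \<subseteq> B1 \<or> core_labels B (\<alpha> ` H) \<subseteq> B2"
    using assms(4) by (auto simp: visibly_blown_up_def act_def)
  then have "\<forall>H\<in>set Hs. subgroup H (free_group B) \<and>
      (core_labels B (\<alpha> ` H) \<subseteq> B1 \<or> core_labels B (\<alpha> ` H) \<subseteq> B2)"
    using sub by blast
  note cut_vertex_exists[OF assms(1,3) B this]
  then obtain x y0 y1 and \<chi> :: "'a letter \<Rightarrow> bool" where
    x: "fst x \<in> B" and y: "fst y0 \<in> B" "fst y1 \<in> B" "y0 \<noteq> x" "y1 \<noteq> x" "\<chi> y0" "\<not> \<chi> y1"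
    and all: "\<forall>H\<in>set Hs. \<forall>g y y'. core_dir B H g y \<longrightarrow> core_dir B H g y' \<longrightarrow>
       y \<noteq> x \<longrightarrow> y' \<noteq> x \<longrightarrow> \<chi> y = \<chi> y'"
    by blast
  have \<chi>: "\<chi> y = \<chi> y'" if "H \<in> set Hs" "core_dir B H g y" "core_dir B H g y'" "y \<noteq> x" "y' \<noteq> x"
    for H g y y'
    using all that by blast
  \<comment> \<open>The colour class that misses the inverse of \<open>x\<close>. It is nonempty
    because \<open>y0\<close> and \<open>y1\<close> have different colours.\<close>
  define A where "A = {y. fst y \<in> B \<and> y \<noteq> x \<and> \<chi> y \<noteq> \<chi> (inv_letter x)}"
  have A: "x \<notin> A" "inv_letter x \<notin> A" "fst ` A \<subseteq> B" by (auto simp: A_def)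
  have "y0 \<in> A \<or> y1 \<in> A" using y by (simp add: A_def)
  then obtain a where a: "a \<in> A" by blast
  have cut: "(\<forall>y. core_dir B H g y \<longrightarrow> y = x \<or> y \<in> A) \<or> (\<forall>y\<in>A. \<not> core_dir B H g y)"
    if H: "H \<in> set Hs" for H g
  proof (rule disjCI, intro allI impI)
    fix y assume y: "core_dir B H g y" and "\<not> (\<forall>y\<in>A. \<not> core_dir B H g y)"
    then obtain z where z: "z \<in> A" "core_dir B H g z" by blast
    have "fst y \<in> B" using core_dir_label[OF y] sub H by blast
    moreover have "\<chi> y = \<chi> z" if "y \<noteq> x"
      using \<chi>[OF H y z(2) that] z(1) A(1) by blast
    ultimately show "y = x \<or> y \<in> A" using z(1) unfolding A_def by blast
  qed
  show ?thesis
  proof (cases "\<exists>H\<in>set Hs. \<exists>g. core_dir B H g x \<and> (\<exists>a\<in>A. core_dir B H g a)")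
    case True
    then show ?thesis
      using whitehead_reduces_complexity[OF assms(2) x A(1,2) cut] by blast
  next
    case no: False
    \<comment> \<open>No vertex joins \<open>x\<close> to \<open>A\<close> here, so \<open>A\<close>
      is a union of components of the Whitehead graph.\<close>
    have sat: "y' \<in> A" if "H \<in> set Hs" "core_dir B H g y" "core_dir B H g y'" "y \<in> A" for H g y y'
      using cut[OF that(1), of g] that no by blast
    show ?thesis
    proof (cases "\<forall>y\<in>A. inv_letter y \<in> A")
      case True
      then have "visibly_blown_up B Hs"
        using sat by (intro visibly_blown_up_if_saturated[OF sub a x A(1,3)]) blast+
      then show ?thesis ..
    next
      case False
      then obtain z where z: "z \<in> A" "inv_letter z \<notin> A" by blast
      have zx: "fst z \<in> B" "fst x \<noteq> fst z"
        using z A by (auto simp: fst_eq_iff_letter)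
      show ?thesis
      proof (cases "\<exists>H\<in>set Hs. \<exists>g. core_dir B H g z")
        case True
        then obtain H g where H: "H \<in> set Hs" "core_dir B H g z" by blast
        then obtain z' where z': "core_dir B H g z'" "z' \<noteq> z"
          using core_dir_two sub by metis
        \<comment> \<open>By saturation the second direction at this vertex also lies in
          \<open>A\<close>, so the Whitehead automorphism with multiplier \<open>z\<close> and set
          \<open>A - {z}\<close> collapses a core edge.\<close>
        then have "z' \<in> A - {z}" using sat H z by blast
        moreover have "(\<forall>y. core_dir B H g y \<longrightarrow> y = z \<or> y \<in> A - {z}) \<or>
            (\<forall>y\<in>A - {z}. \<not> core_dir B H g y)" if "H \<in> set Hs" for H g
          using sat[OF that] by blast
        ultimately show ?thesis
          using whitehead_reduces_complexity[OF assms(2) zx(1), of "A - {z}"] z H z' by blast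
      next
        case False
        then have "visibly_blown_up B Hs"
          using visibly_blown_up_if_unused_label[OF sub zx(1) x, of "snd z"] zx by force
        then show ?thesis ..
      qed
    qed
  qed
qed

section \<open>Transfer to Gersten representatives\<close>

lemma Aut_compose: "\<alpha> \<in> Aut_F B \<Longrightarrow> \<beta> \<in> Aut_F B \<Longrightarrow> \<alpha> \<circ> \<beta> \<in> Aut_F B"
  unfolding Aut_F_def iso_def by (auto intro: hom_compose bij_betw_trans)

lemma act_compose: "act \<alpha> (act \<beta> Hs) = act (\<alpha> \<circ> \<beta>) Hs"
  by (simp add: act_def image_comp)

lemma fin_gen_subgroup_image:
  assumes "\<alpha> \<in> Aut_F B" "fin_gen_subgroup B H"
  shows "fin_gen_subgroup B (\<alpha> ` H)"
proof -
  obtain S where S: "finite S" "S \<subseteq> words B" "H = generate (free_group B) S"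
    and H: "subgroup H (free_group B)"
    using assms unfolding fin_gen_subgroup_def by blast
  have "\<alpha> ` H = generate (free_group B) (\<alpha> ` S)"
    unfolding S(3) by (rule group_hom.generate_img[OF Aut_group_hom[OF assms(1)] S(2), symmetric])
  moreover have "\<alpha> ` S \<subseteq> words B" using S Aut_words[OF assms(1)] by blast
  ultimately show ?thesis
    unfolding fin_gen_subgroup_def using Aut_subgroup[OF assms(1) H] S(1) by blast
qed

theorem lemma9p14:
  fixes B :: "'b set" and Hs :: "'b word set list"
  assumes "finite B"
    and "\<forall>H\<in>set Hs. fin_gen_subgroup B H"
  shows "((\<exists>\<alpha>\<in>Aut_F B. visibly_blown_up B (act \<alpha> Hs)) \<longleftrightarrow>
            (\<exists>Hs'. gersten_rep B Hs Hs' \<and> visibly_blown_up B Hs'))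
       \<and> ((\<exists>Hs'. gersten_rep B Hs Hs' \<and> visibly_blown_up B Hs') \<longleftrightarrow>
            (\<forall>Hs'. gersten_rep B Hs Hs' \<longrightarrow> visibly_blown_up B Hs'))"
proof -
  have "id \<in> Aut_F B" by (auto simp: Aut_F_def id_def intro: iso_set_refl)
  then obtain \<beta>0 where \<beta>0: "\<beta>0 \<in> Aut_F B"
    "\<And>\<alpha>. \<alpha> \<in> Aut_F B \<Longrightarrow> complexity B (act \<beta>0 Hs) \<le> complexity B (act \<alpha> Hs)"
    using ex_has_least_nat[of "\<lambda>\<alpha>. \<alpha> \<in> Aut_F B" id "\<lambda>\<alpha>. complexity B (act \<alpha> Hs)"] by blast
  \<comment> \<open>Complexities are natural numbers, so a minimum over the orbit exists; this is
    what makes the third condition imply the second.\<close>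
  then have ex: "\<exists>Hs'. gersten_rep B Hs Hs'"
    unfolding gersten_rep_def by blast
  have 1: "\<exists>\<alpha>\<in>Aut_F B. visibly_blown_up B (act \<alpha> Hs)"
    if "gersten_rep B Hs Hs'" "visibly_blown_up B Hs'" for Hs'
    using that unfolding gersten_rep_def by blast
  have 3: "visibly_blown_up B Hs'"
    if \<alpha>: "\<alpha> \<in> Aut_F B" "visibly_blown_up B (act \<alpha> Hs)" and "gersten_rep B Hs Hs'" for \<alpha> Hs'
  proof -
    obtain \<beta> where \<beta>: "\<beta> \<in> Aut_F B" "Hs' = act \<beta> Hs"
      and least: "\<And>\<alpha>. \<alpha> \<in> Aut_F B \<Longrightarrow> complexity B Hs' \<le> complexity B (act \<alpha> Hs)"
      using \<open>gersten_rep B Hs Hs'\<close> unfolding gersten_rep_def by blast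
    \<comment> \<open>Going back from \<open>Hs'\<close> to \<open>Hs\<close> and then applying
      \<open>\<alpha>\<close> blows up \<open>Hs'\<close> itself, so the dichotomy applies to
      \<open>Hs'\<close>; its second alternative contradicts minimality.\<close>
    let ?\<gamma> = "inv_into (words B) \<beta>"
    have "?\<gamma> ` \<beta> ` H = H" if "H \<in> set Hs" for H
    proof -
      have "H \<subseteq> words B"
        using assms(2) that by (auto simp: fin_gen_subgroup_def dest: subgroup_words)
      then show ?thesis
        using inv_into_image_cancel[OF Aut_inj[OF \<beta>(1)]] by blast
    qed
    then have "act ?\<gamma> Hs' = Hs" by (simp add: \<beta>(2) act_def map_idI)
    then have "visibly_blown_up B (act (\<alpha> \<circ> ?\<gamma>) Hs')"
      using \<alpha>(2) by (simp flip: act_compose)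
    moreover have "\<forall>H\<in>set Hs'. fin_gen_subgroup B H"
      using assms(2) fin_gen_subgroup_image[OF \<beta>(1)] by (auto simp: \<beta>(2) act_def)
    ultimately have "visibly_blown_up B Hs' \<or>
        (\<exists>\<phi>\<in>Aut_F B. complexity B (act \<phi> Hs') < complexity B Hs')"
      using visibly_blown_up_or_reducible[OF assms(1)] Aut_compose[OF \<alpha>(1) Aut_inv_into[OF \<beta>(1)]]
      by blast
    moreover have "complexity B Hs' \<le> complexity B (act \<phi> Hs')" if "\<phi> \<in> Aut_F B" for \<phi>
      using least[OF Aut_compose[OF that \<beta>(1)]] by (simp add: \<beta>(2) act_compose)
    ultimately show ?thesis by (meson not_le)
  qed
  show ?thesis using ex 1 3 by blast
qed

end
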